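(* Let $L>0$, $\Omega=(-L,L)^2$, $\alpha\in(0,L)$, $M>0$, and set $$u_0=-M\,\chi_{(-\alpha,\alpha)^2}\ \text{ on }\Omega,\qquad T_{ext}=M\left(\frac2\alpha+\frac{2\alpha}{L^2-\alpha^2}\right)^{-1}.$$ Then the unique solution $u$ of $$\frac{\partial u}{\partial t}=\mathrm{div}\left(\frac{u_{x_1}}{|u_{x_1}|},\frac{u_{x_2}}{|u_{x_2}|}\right)\quad\text{in }\Omega$$ with homogeneous Neumann boundary conditions and initial datum $u_0$ is given, for $0\le t\le T_{ext}$, by $$u(x,t)=\begin{cases}\dfrac{2t}{\alpha}-M, & |x_1|\le\alpha,\ |x_2|\le\alpha,\\[6pt] -\dfrac{2\alpha}{L^2-\alpha^2}\,t, & \text{otherwise.}\end{cases}$$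
   Context: The equation with homogeneous Neumann boundary conditions is understood as the $L^2(\Omega)$-gradient flow of the convex functional $\Phi_0:L^2(\Omega)\to[0,\infty]$, $$\Phi_0(u)=\sup\left\{\int_\Omega u\,\mathrm{div}\,z\,dx:\ z\in C_c^1(\Omega;\mathbb{R}^2),\ \max(|z_1|,|z_2|)\le1\right\}$$ (finite exactly on $BV(\Omega)\cap L^2(\Omega)$). That is, the solution with $u_0\in L^2(\Omega)$ is the unique $u\in C([0,\infty);L^2(\Omega))$, Lipschitz continuous on $[\delta,\infty)$ for each $\delta>0$, with $u(0)=u_0$ and $-\frac{d^+u}{dt}(t)\in\partial\Phi_0(u(t))$ for all $t>0$, where $\partial\Phi_0$ is the subdifferential in $L^2(\Omega)$ and $d^+/dt$ the right derivative. *)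

theory Defs
  imports "HOL-Analysis.Analysis"
begin

text \<open>
  Elements of \<open>L\<^sup>2(\<Omega>)\<close> are represented by functions on the whole plane of which only the
  values on \<open>\<Omega>\<close> matter; equality in \<open>L\<^sup>2(\<Omega>)\<close> is equality almost everywhere on \<open>\<Omega>\<close>.
\<close>

definition L2 :: "(real^2) set \<Rightarrow> (real^2 \<Rightarrow> real) set" where
  "L2 \<Omega> = {f. f \<in> borel_measurable (lebesgue_on \<Omega>) \<and>
               integrable (lebesgue_on \<Omega>) (\<lambda>x. (f x)\<^sup>2)}"

definition L2_inner :: "(real^2) set \<Rightarrow> (real^2 \<Rightarrow> real) \<Rightarrow> (real^2 \<Rightarrow> real) \<Rightarrow> real" where
  "L2_inner \<Omega> f g = (LINT x|lebesgue_on \<Omega>. f x * g x)"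

definition L2_norm_on :: "(real^2) set \<Rightarrow> (real^2 \<Rightarrow> real) \<Rightarrow> real" where
  "L2_norm_on \<Omega> f = sqrt (L2_inner \<Omega> f f)"

definition divergence :: "(real^2 \<Rightarrow> real^2) \<Rightarrow> real^2 \<Rightarrow> real" where
  "divergence z x = (\<Sum>i\<in>UNIV. frechet_derivative z (at x) (axis i 1) $ i)"

text \<open>
  \<open>C\<^sub>c\<^sup>1(\<Omega>;\<real>\<^sup>2)\<close> for open \<open>\<Omega>\<close>: fields are extended by zero outside \<open>\<Omega>\<close>, which keeps them \<open>C\<^sup>1\<close>.
\<close>

definition Cc1 :: "(real^2) set \<Rightarrow> (real^2 \<Rightarrow> real^2) set" where
  "Cc1 \<Omega> = {z. (\<exists>z' :: real^2 \<Rightarrow> (real^2) \<Rightarrow>\<^sub>L (real^2).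
                   (\<forall>x. (z has_derivative blinfun_apply (z' x)) (at x)) \<and> continuous_on UNIV z') \<and>
               compact (closure {x. z x \<noteq> 0}) \<and> closure {x. z x \<noteq> 0} \<subseteq> \<Omega>}"

definition \<Phi>\<^sub>0 :: "(real^2) set \<Rightarrow> (real^2 \<Rightarrow> real) \<Rightarrow> ereal" where
  "\<Phi>\<^sub>0 \<Omega> u = (SUP z\<in>{z \<in> Cc1 \<Omega>. \<forall>x. max \<bar>z x $ 1\<bar> \<bar>z x $ 2\<bar> \<le> 1}.
                 ereal (LINT x|lebesgue_on \<Omega>. u x * divergence z x))"

definition L2_subdifferential ::
    "(real^2) set \<Rightarrow> ((real^2 \<Rightarrow> real) \<Rightarrow> ereal) \<Rightarrow> (real^2 \<Rightarrow> real) \<Rightarrow> (real^2 \<Rightarrow> real) set" where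
  "L2_subdifferential \<Omega> \<Phi> u =
     {w \<in> L2 \<Omega>. u \<in> L2 \<Omega> \<and> \<Phi> u < \<infinity> \<and>
        (\<forall>v\<in>L2 \<Omega>. \<Phi> u + ereal (L2_inner \<Omega> w (\<lambda>x. v x - u x)) \<le> \<Phi> v)}"

definition L2_has_right_derivative ::
    "(real^2) set \<Rightarrow> (real \<Rightarrow> real^2 \<Rightarrow> real) \<Rightarrow> (real^2 \<Rightarrow> real) \<Rightarrow> real \<Rightarrow> bool" where
  "L2_has_right_derivative \<Omega> u w t \<longleftrightarrow> w \<in> L2 \<Omega> \<and>
     ((\<lambda>h. L2_norm_on \<Omega> (\<lambda>x. (u (t + h) x - u t x) / h - w x)) \<longlongrightarrow> 0) (at_right 0)"

text \<open>
  Solutions of \<open>u\<^sub>t = div (u\<^sub>x\<^sub>1 / |u\<^sub>x\<^sub>1|, u\<^sub>x\<^sub>2 / |u\<^sub>x\<^sub>2|)\<close> in \<open>\<Omega>\<close> with homogeneous Neumann boundary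
  conditions, understood as the \<open>L\<^sup>2(\<Omega>)\<close>-gradient flow of \<open>\<Phi>\<^sub>0\<close>.
\<close>

definition neumann_flow_solution ::
    "(real^2) set \<Rightarrow> (real^2 \<Rightarrow> real) \<Rightarrow> (real \<Rightarrow> real^2 \<Rightarrow> real) \<Rightarrow> bool" where
  "neumann_flow_solution \<Omega> u\<^sub>0 u \<longleftrightarrow>
     (\<forall>t\<ge>0. u t \<in> L2 \<Omega>) \<and>
     (\<forall>t\<ge>0. ((\<lambda>s. L2_norm_on \<Omega> (\<lambda>x. u s x - u t x)) \<longlongrightarrow> 0) (at t within {0..})) \<and>
     (\<forall>\<delta>>0. \<exists>C. \<forall>s\<ge>\<delta>. \<forall>t\<ge>\<delta>. L2_norm_on \<Omega> (\<lambda>x. u s x - u t x) \<le> C * \<bar>s - t\<bar>) \<and>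
     (AE x in lebesgue_on \<Omega>. u 0 x = u\<^sub>0 x) \<and>
     (\<forall>t>0. \<exists>w. L2_has_right_derivative \<Omega> u w t \<and>
                (\<lambda>x. - w x) \<in> L2_subdifferential \<Omega> (\<Phi>\<^sub>0 \<Omega>) (u t))"

definition open_square :: "real \<Rightarrow> (real^2) set" where
  "open_square r = {x. \<bar>x $ 1\<bar> < r \<and> \<bar>x $ 2\<bar> < r}"

end

theory Submission
  imports Defs
begin

text \<open>
  Write \<open>c = 2 \<alpha> / (L\<^sup>2 - \<alpha>\<^sup>2)\<close>. The candidate is a square well of depth shrinking at constant speed: inside
  the small square it rises with velocity \<open>2 / \<alpha>\<close>, outside it sinks with velocity \<open>- c\<close>, which keeps the
  mean value, and it stops at the moment \<open>T\<^sub>e\<^sub>x\<^sub>t\<close> at which the two levels meet. So three things carry the proof.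

  \<^emph>\<open>Uniqueness.\<close> Subdifferentials are monotone, so the right derivative of
  \<open>t \<mapsto> \<parallel>u t - v t\<parallel>\<^sup>2\<close> is at most \<open>0\<close> for two solutions \<open>u\<close>, \<open>v\<close>. A continuous function with this property is
  nonincreasing, hence two solutions with the same initial datum coincide (\<open>neumann_flow_unique\<close>).

  \<^emph>\<open>Calibration.\<close> A function \<open>w\<close> belongs to the subdifferential at \<open>u\<close> as soon as \<open>\<langle>w, v\<rangle> \<le> \<Phi>\<^sub>0 v\<close> for all \<open>v\<close> and
  \<open>\<Phi>\<^sub>0 u \<le> \<langle>w, u\<rangle>\<close>; for functionals like \<open>\<Phi>\<^sub>0\<close> that are positively homogeneous of degree one, all
  subgradients arise in this way. The first inequality
  holds if \<open>w = div z\<close> for a field \<open>z\<close> with components in \<open>[- 1, 1]\<close> and vanishing normal component on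
  the boundary. For minus the velocity above, such a field is
  \<open>z x = (- k x\<^sub>2 * h x\<^sub>1, - k x\<^sub>1 * h x\<^sub>2)\<close>, where \<open>h\<close> is the odd piecewise linear function that is \<open>0\<close> at \<open>0\<close>
  and \<open>\<plusminus>L\<close> and \<open>\<plusminus>1\<close> at \<open>\<plusminus>\<alpha>\<close>, and \<open>k\<close> equals \<open>1\<close> on \<open>(- \<alpha>, \<alpha>)\<close> and \<open>\<alpha> / (L + \<alpha>)\<close> on the rest of \<open>(- L, L)\<close>.
  The product structure is what makes the approximation by admissible test fields easy: only \<open>h\<close> is
  ever differentiated in \<open>div z\<close>, so it suffices to replace \<open>h\<close> and \<open>k\<close> by compactly supported
  \<open>C\<^sup>1\<close> functions such that \<open>h\<^sub>n'\<close> stays bounded and \<open>h\<^sub>n' \<longrightarrow> h'\<close>, \<open>k\<^sub>n \<longrightarrow> k\<close> almost everywhere, and to use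
  dominated convergence (\<open>tensor_calibration\<close>, \<open>calibration_le_\<Phi>\<^sub>0\<close>).

  \<^emph>\<open>Value of the functional.\<close> For the function with level \<open>p\<close> in the small square and \<open>q \<ge> p\<close> outside,
  the divergence theorem on squares bounds every \<open>\<integral> u div z\<close> by the jump \<open>q - p\<close> times the perimeter
  \<open>8 \<alpha>\<close> (\<open>\<Phi>\<^sub>0_two_level_le\<close>), and \<open>8 \<alpha> (q - p)\<close> is exactly \<open>\<langle>w, u\<rangle>\<close>.
\<close>

section \<open>The inner product space of square integrable functions\<close>

lemma L2_measurable: "f \<in> L2 \<Omega> \<Longrightarrow> f \<in> borel_measurable (lebesgue_on \<Omega>)"
  by (simp add: L2_def)

lemma L2_integrable_mult:
  assumes f: "f \<in> L2 \<Omega>" and g: "g \<in> L2 \<Omega>"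
  shows "integrable (lebesgue_on \<Omega>) (\<lambda>x. f x * g x)"
proof (rule Bochner_Integration.integrable_bound)
  show "integrable (lebesgue_on \<Omega>) (\<lambda>x. (f x)\<^sup>2 + (g x)\<^sup>2)"
    using f g by (simp add: L2_def)
  show "(\<lambda>x. f x * g x) \<in> borel_measurable (lebesgue_on \<Omega>)"
    using f g by (auto simp: L2_def)
  have "\<bar>a * b\<bar> \<le> a\<^sup>2 + b\<^sup>2" for a b :: real
    using sum_squares_bound[of "\<bar>a\<bar>" "\<bar>b\<bar>"] mult_nonneg_nonneg[of "\<bar>a\<bar>" "\<bar>b\<bar>"]
    unfolding abs_mult power2_abs by linarith
  then show "AE x in lebesgue_on \<Omega>. norm (f x * g x) \<le> norm ((f x)\<^sup>2 + (g x)\<^sup>2)"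
    by (auto intro!: AE_I2 simp: abs_of_nonneg)
qed

lemma L2_add:
  assumes f: "f \<in> L2 \<Omega>" and g: "g \<in> L2 \<Omega>"
  shows "(\<lambda>x. f x + g x) \<in> L2 \<Omega>"
  using f g L2_integrable_mult[OF f g] by (auto simp: L2_def power2_sum mult.assoc)

lemma L2_cmult: "f \<in> L2 \<Omega> \<Longrightarrow> (\<lambda>x. c * f x) \<in> L2 \<Omega>"
  by (auto simp: L2_def power_mult_distrib)

lemma L2_diff: "f \<in> L2 \<Omega> \<Longrightarrow> g \<in> L2 \<Omega> \<Longrightarrow> (\<lambda>x. f x - g x) \<in> L2 \<Omega>"
  using L2_add[of f \<Omega> "\<lambda>x. (-1) * g x"] L2_cmult[of g \<Omega> "-1"] by simp

lemma L2_minus: "f \<in> L2 \<Omega> \<Longrightarrow> (\<lambda>x. - f x) \<in> L2 \<Omega>"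
  using L2_cmult[of f \<Omega> "-1"] by simp

lemma L2_divide: "f \<in> L2 \<Omega> \<Longrightarrow> (\<lambda>x. f x / c) \<in> L2 \<Omega>"
  using L2_cmult[of f \<Omega> "1/c"] by simp

lemma L2_inner_commute: "L2_inner \<Omega> f g = L2_inner \<Omega> g f"
  by (simp add: L2_inner_def mult.commute)

lemma L2_inner_add_right:
  assumes "f \<in> L2 \<Omega>" "g \<in> L2 \<Omega>" "h \<in> L2 \<Omega>"
  shows "L2_inner \<Omega> f (\<lambda>x. g x + h x) = L2_inner \<Omega> f g + L2_inner \<Omega> f h"
  using assms by (simp add: L2_inner_def distrib_left L2_integrable_mult)

lemma L2_inner_diff_right:
  assumes "f \<in> L2 \<Omega>" "g \<in> L2 \<Omega>" "h \<in> L2 \<Omega>"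
  shows "L2_inner \<Omega> f (\<lambda>x. g x - h x) = L2_inner \<Omega> f g - L2_inner \<Omega> f h"
  using assms by (simp add: L2_inner_def right_diff_distrib L2_integrable_mult)

lemma L2_inner_diff_left:
  assumes "f \<in> L2 \<Omega>" "g \<in> L2 \<Omega>" "h \<in> L2 \<Omega>"
  shows "L2_inner \<Omega> (\<lambda>x. f x - g x) h = L2_inner \<Omega> f h - L2_inner \<Omega> g h"
  using assms by (simp add: L2_inner_def left_diff_distrib L2_integrable_mult)

lemma L2_inner_minus_left: "L2_inner \<Omega> (\<lambda>x. - f x) g = - L2_inner \<Omega> f g"
  by (simp add: L2_inner_def)

lemma L2_inner_cmult_right: "L2_inner \<Omega> f (\<lambda>x. c * g x) = c * L2_inner \<Omega> f g"
  by (simp add: L2_inner_def mult.left_commute[of _ c])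

lemma L2_inner_self_nonneg: "0 \<le> L2_inner \<Omega> f f"
  by (simp add: L2_inner_def)

lemma L2_norm_on_nonneg [simp]: "0 \<le> L2_norm_on \<Omega> f"
  by (simp add: L2_norm_on_def L2_inner_self_nonneg)

lemma L2_norm_on_square: "(L2_norm_on \<Omega> f)\<^sup>2 = L2_inner \<Omega> f f"
  by (simp add: L2_norm_on_def L2_inner_self_nonneg)

lemma L2_norm_on_add_square:
  assumes "f \<in> L2 \<Omega>" "g \<in> L2 \<Omega>"
  shows "(L2_norm_on \<Omega> (\<lambda>x. f x + g x))\<^sup>2
         = (L2_norm_on \<Omega> f)\<^sup>2 + 2 * L2_inner \<Omega> f g + (L2_norm_on \<Omega> g)\<^sup>2"
proof -
  note fg = L2_add[OF assms]
  have "L2_inner \<Omega> (\<lambda>x. f x + g x) (\<lambda>x. f x + g x)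
        = L2_inner \<Omega> f (\<lambda>x. f x + g x) + L2_inner \<Omega> g (\<lambda>x. f x + g x)"
    using assms fg by (subst (1 2 3) L2_inner_commute) (simp add: L2_inner_add_right)
  also have "\<dots> = L2_inner \<Omega> f f + 2 * L2_inner \<Omega> f g + L2_inner \<Omega> g g"
    using assms by (simp add: L2_inner_add_right L2_inner_commute[of \<Omega> g f])
  finally show ?thesis
    by (simp add: L2_norm_on_square)
qed

lemma L2_norm_on_cmult: "L2_norm_on \<Omega> (\<lambda>x. c * f x) = \<bar>c\<bar> * L2_norm_on \<Omega> f"
proof -
  have "L2_inner \<Omega> (\<lambda>x. c * f x) (\<lambda>x. c * f x) = c\<^sup>2 * L2_inner \<Omega> f f"
    by (simp add: L2_inner_cmult_right L2_inner_commute[of \<Omega> "\<lambda>x. c * f x" f] power2_eq_square)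
  then show ?thesis
    by (simp add: L2_norm_on_def real_sqrt_mult)
qed

text \<open>
  The quadratic polynomial \<open>t \<mapsto> \<parallel>f + t g\<parallel>\<^sup>2\<close> is nonnegative, so its discriminant is not positive.
\<close>

lemma L2_Cauchy_Schwarz:
  assumes f: "f \<in> L2 \<Omega>" and g: "g \<in> L2 \<Omega>"
  shows "\<bar>L2_inner \<Omega> f g\<bar> \<le> L2_norm_on \<Omega> f * L2_norm_on \<Omega> g"
proof -
  let ?a = "L2_inner \<Omega> f f" and ?b = "L2_inner \<Omega> f g" and ?c = "L2_inner \<Omega> g g"
  have quad: "0 \<le> ?a + 2 * t * ?b + t\<^sup>2 * ?c" for t
    using zero_le_power2[of "L2_norm_on \<Omega> (\<lambda>x. f x + t * g x)"]
    unfolding L2_norm_on_add_square[OF f L2_cmult[OF g]] L2_inner_cmult_right L2_norm_on_cmult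
      power_mult_distrib power2_abs unfolding L2_norm_on_square by (simp add: mult.assoc)
  have "?b\<^sup>2 \<le> ?a * ?c"
  proof (cases "?c = 0")
    case True
    \<comment> \<open>An affine function of \<open>t\<close> that is bounded below is constant.\<close>
    have "?b = 0"
    proof (rule ccontr)
      assume b: "?b \<noteq> 0"
      then show False
        using quad[of "- (?a + 1) / (2 * ?b)"] True by (simp add: field_simps)
    qed
    then show ?thesis using True by simp
  next
    case False
    then have c: "?c > 0" using L2_inner_self_nonneg[of \<Omega> g] by simp
    have "0 \<le> ?c * (?a + 2 * (- ?b / ?c) * ?b + (- ?b / ?c)\<^sup>2 * ?c)"
      using quad[of "- ?b / ?c"] c by (intro mult_nonneg_nonneg) auto
    also have "\<dots> = ?a * ?c - ?b\<^sup>2"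
      using c by (simp add: field_simps power2_eq_square)
    finally show ?thesis by simp
  qed
  then have "\<bar>?b\<bar> \<le> sqrt (?a * ?c)"
    using real_le_rsqrt by (metis power2_abs)
  then show ?thesis
    by (simp add: L2_norm_on_def real_sqrt_mult)
qed

lemma L2_norm_on_triangle:
  assumes "f \<in> L2 \<Omega>" "g \<in> L2 \<Omega>"
  shows "L2_norm_on \<Omega> (\<lambda>x. f x + g x) \<le> L2_norm_on \<Omega> f + L2_norm_on \<Omega> g"
proof (rule power2_le_imp_le)
  show "(L2_norm_on \<Omega> (\<lambda>x. f x + g x))\<^sup>2 \<le> (L2_norm_on \<Omega> f + L2_norm_on \<Omega> g)\<^sup>2"
    using L2_Cauchy_Schwarz[OF assms]
    by (simp add: L2_norm_on_add_square[OF assms] power2_sum)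
qed simp

lemma L2_norm_on_minus: "L2_norm_on \<Omega> (\<lambda>x. - f x) = L2_norm_on \<Omega> f"
  using L2_norm_on_cmult[of \<Omega> "-1" f] by simp

lemma L2_norm_on_triangle_diff:
  assumes "f \<in> L2 \<Omega>" "g \<in> L2 \<Omega>"
  shows "L2_norm_on \<Omega> (\<lambda>x. f x - g x) \<le> L2_norm_on \<Omega> f + L2_norm_on \<Omega> g"
  using L2_norm_on_triangle[OF assms(1) L2_minus[OF assms(2)]] by (simp add: L2_norm_on_minus)

lemma L2_norm_on_reverse_triangle:
  assumes f: "f \<in> L2 \<Omega>" and g: "g \<in> L2 \<Omega>"
  shows "\<bar>L2_norm_on \<Omega> f - L2_norm_on \<Omega> g\<bar> \<le> L2_norm_on \<Omega> (\<lambda>x. f x - g x)"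
proof -
  have "L2_norm_on \<Omega> f \<le> L2_norm_on \<Omega> g + L2_norm_on \<Omega> (\<lambda>x. f x - g x)"
    using L2_norm_on_triangle[OF g L2_diff[OF f g]] by simp
  moreover have "L2_norm_on \<Omega> g \<le> L2_norm_on \<Omega> f + L2_norm_on \<Omega> (\<lambda>x. f x - g x)"
    using L2_norm_on_triangle_diff[OF f L2_diff[OF f g]] by simp
  ultimately show ?thesis by simp
qed

lemma L2_norm_on_eq_0_imp_AE:
  assumes f: "f \<in> L2 \<Omega>" and "L2_norm_on \<Omega> f = 0"
  shows "AE x in lebesgue_on \<Omega>. f x = 0"
proof -
  have "integral\<^sup>L (lebesgue_on \<Omega>) (\<lambda>x. f x * f x) = 0"
    using assms(2) L2_norm_on_square[of \<Omega> f] by (simp add: L2_inner_def)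
  moreover have "integrable (lebesgue_on \<Omega>) (\<lambda>x. f x * f x)"
    by (rule L2_integrable_mult[OF f f])
  ultimately have "AE x in lebesgue_on \<Omega>. f x * f x = 0"
    by (subst (asm) integral_nonneg_eq_0_iff_AE) auto
  then show ?thesis by simp
qed

lemma L2_norm_on_cong_AE_0:
  assumes "f \<in> borel_measurable (lebesgue_on \<Omega>)" "AE x in lebesgue_on \<Omega>. f x = 0"
  shows "L2_norm_on \<Omega> f = 0"
proof -
  have "integral\<^sup>L (lebesgue_on \<Omega>) (\<lambda>x. f x * f x) = integral\<^sup>L (lebesgue_on \<Omega>) (\<lambda>x. 0)"
    using assms by (intro integral_cong_AE) auto
  then show ?thesis by (simp add: L2_norm_on_def L2_inner_def)
qed

section \<open>Uniqueness of gradient flows\<close>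

text \<open>
  For each \<open>\<epsilon> > 0\<close>, the points \<open>s\<close> with \<open>f s - f a \<le> \<epsilon> (s - a)\<close> form a compact set. Its largest element must be \<open>b\<close>,
  because from any earlier point the bound on the right difference quotients leads to a later one.
\<close>

lemma nonincreasing_if_right_Dini_nonpos:
  fixes f :: "real \<Rightarrow> real"
  assumes ab: "a \<le> b" and cont: "continuous_on {a..b} f"
    and dini: "\<And>t \<epsilon>. \<lbrakk>a \<le> t; t < b; 0 < \<epsilon>\<rbrakk> \<Longrightarrow> \<forall>\<^sub>F h in at_right 0. f (t + h) - f t \<le> \<epsilon> * h"
  shows "f b \<le> f a"
proof -
  have *: "f b - f a \<le> \<epsilon> * (b - a)" if \<epsilon>: "0 < \<epsilon>" for \<epsilon>
  proof -
    define S where "S = {s \<in> {a..b}. f s - f a - \<epsilon> * (s - a) \<le> 0}"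
    have "compact S"
      unfolding compact_eq_bounded_closed
    proof
      show "bounded S" unfolding S_def by (rule bounded_subset[of "{a..b}"]) auto
      show "closed S" unfolding S_def
        by (rule continuous_on_closed_Collect_le) (auto intro!: continuous_intros cont)
    qed
    moreover have "S \<noteq> {}" using ab by (auto simp: S_def)
    ultimately obtain c where c: "c \<in> S" and max: "\<And>s. s \<in> S \<Longrightarrow> s \<le> c"
      using compact_attains_sup[of S] by metis
    have "c = b"
    proof (rule ccontr)
      assume "c \<noteq> b"
      with c have cb: "a \<le> c" "c < b" by (auto simp: S_def)
      have "\<forall>\<^sub>F h in at_right 0. h < b - c"
        using cb by (intro order_tendstoD[OF tendsto_ident_at]) auto
      with dini[OF cb \<epsilon>] eventually_at_right_less[of "0::real"]
      have "\<forall>\<^sub>F h in at_right 0. f (c + h) - f c \<le> \<epsilon> * h \<and> 0 < h \<and> h < b - c"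
        by eventually_elim auto
      then obtain h where h: "f (c + h) - f c \<le> \<epsilon> * h" "0 < h" "h < b - c"
        using eventually_happens'[OF trivial_limit_at_right_real] by blast
      then have "c + h \<in> S" using c by (auto simp: S_def algebra_simps)
      with max h show False by fastforce
    qed
    with c show ?thesis by (simp add: S_def)
  qed
  show ?thesis
  proof (rule ccontr)
    assume neg: "\<not> f b \<le> f a"
    with ab have "a < b" by (cases "a = b") auto
    have cancel: "x / y * y = x" if "y \<noteq> 0" for x y :: real using that by simp
    from neg \<open>a < b\<close> have "f b - f a \<le> (f b - f a) / 2 / (b - a) * (b - a)"
      by (intro *) simp
    also have "\<dots> = (f b - f a) / 2" using \<open>a < b\<close> by (intro cancel) simp
    finally show False using neg by simp
  qed
qed

text \<open>
  Adding the two subgradient inequalities cancels the values of \<open>\<Phi>\<close>, which have to be finite for this.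
\<close>

lemma subdifferential_monotone:
  assumes w1: "w1 \<in> L2_subdifferential \<Omega> \<Phi> u1" and w2: "w2 \<in> L2_subdifferential \<Omega> \<Phi> u2"
    and nn: "0 \<le> \<Phi> u1" "0 \<le> \<Phi> u2"
  shows "0 \<le> L2_inner \<Omega> (\<lambda>x. u1 x - u2 x) (\<lambda>x. w1 x - w2 x)"
proof -
  have L: "w1 \<in> L2 \<Omega>" "w2 \<in> L2 \<Omega>" "u1 \<in> L2 \<Omega>" "u2 \<in> L2 \<Omega>"
    using assms by (auto simp: L2_subdifferential_def)
  obtain p1 where p1: "\<Phi> u1 = ereal p1"
    using w1 nn by (cases "\<Phi> u1") (auto simp: L2_subdifferential_def)
  obtain p2 where p2: "\<Phi> u2 = ereal p2"
    using w2 nn by (cases "\<Phi> u2") (auto simp: L2_subdifferential_def)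
  have "p1 + L2_inner \<Omega> w1 (\<lambda>x. u2 x - u1 x) \<le> p2"
    using w1 L p1 p2 by (auto simp: L2_subdifferential_def)
  moreover have "p2 + L2_inner \<Omega> w2 (\<lambda>x. u1 x - u2 x) \<le> p1"
    using w2 L p1 p2 by (auto simp: L2_subdifferential_def)
  ultimately have "0 \<le> L2_inner \<Omega> w1 (\<lambda>x. u1 x - u2 x) - L2_inner \<Omega> w2 (\<lambda>x. u1 x - u2 x)"
    using L by (simp add: L2_inner_diff_right)
  also have "\<dots> = L2_inner \<Omega> (\<lambda>x. u1 x - u2 x) (\<lambda>x. w1 x - w2 x)"
    using L by (subst (3) L2_inner_commute) (simp add: L2_inner_diff_left L2_diff)
  finally show ?thesis .
qed

lemma zero_in_Cc1: "(\<lambda>x. 0) \<in> Cc1 \<Omega>"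
  unfolding Cc1_def by (auto intro!: exI[of _ "\<lambda>x. 0"] continuous_intros simp: zero_blinfun.rep_eq)

lemma \<Phi>\<^sub>0_nonneg: "0 \<le> \<Phi>\<^sub>0 \<Omega> u"
proof -
  have "divergence (\<lambda>x. 0) x = 0" for x
    by (simp add: divergence_def frechet_derivative_const)
  then have "ereal 0 = ereal (LINT x|lebesgue_on \<Omega>. u x * divergence (\<lambda>x. 0) x)"
    by simp
  also have "\<dots> \<le> \<Phi>\<^sub>0 \<Omega> u"
    unfolding \<Phi>\<^sub>0_def by (rule SUP_upper) (simp add: zero_in_Cc1)
  finally show ?thesis by (simp add: zero_ereal_def)
qed

text \<open>
  Expanding the square,
  \<open>\<parallel>D (t + h)\<parallel>\<^sup>2 - \<parallel>D t\<parallel>\<^sup>2 = 2 h \<langle>D t, w + e\<rangle> + h\<^sup>2 \<parallel>w + e\<parallel>\<^sup>2\<close> with an error \<open>e\<close> that tends to \<open>0\<close> in norm, so the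
  sign of \<open>\<langle>D t, w\<rangle>\<close> controls the right derivative.
\<close>

lemma right_difference_quotient_le:
  assumes D: "\<And>s. t \<le> s \<Longrightarrow> D s \<in> L2 \<Omega>" and w: "L2_has_right_derivative \<Omega> D w t"
    and neg: "L2_inner \<Omega> (D t) w \<le> 0" and \<epsilon>: "0 < \<epsilon>"
  shows "\<forall>\<^sub>F h in at_right 0. (L2_norm_on \<Omega> (D (t + h)))\<^sup>2 - (L2_norm_on \<Omega> (D t))\<^sup>2 \<le> \<epsilon> * h"
proof -
  define e where "e h = (\<lambda>x. (D (t + h) x - D t x) / h - w x)" for h
  let ?N = "L2_norm_on \<Omega>"
  have wL: "w \<in> L2 \<Omega>" and lim: "((\<lambda>h. ?N (e h)) \<longlongrightarrow> 0) (at_right 0)"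
    using w by (auto simp: L2_has_right_derivative_def e_def)
  have "((\<lambda>h. 2 * ?N (D t) * ?N (e h) + h * (?N w + ?N (e h))\<^sup>2) \<longlongrightarrow>
          2 * ?N (D t) * 0 + 0 * (?N w + 0)\<^sup>2) (at_right 0)"
    by (intro tendsto_intros lim)
  then have small: "\<forall>\<^sub>F h in at_right 0. 2 * ?N (D t) * ?N (e h) + h * (?N w + ?N (e h))\<^sup>2 < \<epsilon>"
    using \<epsilon> by (intro order_tendstoD) auto
  show ?thesis
    using small eventually_at_right_less[of "0::real"]
  proof eventually_elim
    case (elim h)
    have Dt: "D t \<in> L2 \<Omega>" "D (t + h) \<in> L2 \<Omega>" using D elim by auto
    have eL: "e h \<in> L2 \<Omega>"
      unfolding e_def by (intro L2_diff L2_divide Dt wL)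
    have we: "(\<lambda>x. w x + e h x) \<in> L2 \<Omega>" by (intro L2_add wL eL)
    have eq: "D (t + h) = (\<lambda>x. D t x + h * (w x + e h x))"
      using elim by (auto simp: e_def)
    have "(?N (D (t + h)))\<^sup>2
          = (?N (D t))\<^sup>2 + 2 * (h * L2_inner \<Omega> (D t) (\<lambda>x. w x + e h x)) + h\<^sup>2 * (?N (\<lambda>x. w x + e h x))\<^sup>2"
      by (subst eq, subst L2_norm_on_add_square[OF Dt(1) L2_cmult[OF we]])
        (simp add: L2_inner_cmult_right L2_norm_on_cmult power_mult_distrib)
    then have expand: "(?N (D (t + h)))\<^sup>2 - (?N (D t))\<^sup>2
        = h * (2 * L2_inner \<Omega> (D t) w + 2 * L2_inner \<Omega> (D t) (e h) + h * (?N (\<lambda>x. w x + e h x))\<^sup>2)"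
      by (simp add: L2_inner_add_right Dt wL eL algebra_simps power2_eq_square)
    have "L2_inner \<Omega> (D t) (e h) \<le> ?N (D t) * ?N (e h)"
      using L2_Cauchy_Schwarz[OF Dt(1) eL] by simp
    moreover have "h * (?N (\<lambda>x. w x + e h x))\<^sup>2 \<le> h * (?N w + ?N (e h))\<^sup>2"
      using elim by (intro mult_left_mono power_mono L2_norm_on_triangle wL eL) auto
    ultimately have "2 * L2_inner \<Omega> (D t) w + 2 * L2_inner \<Omega> (D t) (e h) + h * (?N (\<lambda>x. w x + e h x))\<^sup>2 \<le> \<epsilon>"
      using neg elim by linarith
    then show ?case
      unfolding expand using elim by (simp add: mult.commute[of \<epsilon>])
  qed
qed

lemma L2_has_right_derivative_diff:
  assumes u: "L2_has_right_derivative \<Omega> u w1 t" and v: "L2_has_right_derivative \<Omega> v w2 t"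
    and uL: "\<And>s. t \<le> s \<Longrightarrow> u s \<in> L2 \<Omega>" and vL: "\<And>s. t \<le> s \<Longrightarrow> v s \<in> L2 \<Omega>"
  shows "L2_has_right_derivative \<Omega> (\<lambda>s x. u s x - v s x) (\<lambda>x. w1 x - w2 x) t"
proof -
  let ?e = "\<lambda>u w h x. (u (t + h) x - u t x) / h - w x"
  let ?uv = "\<lambda>s x. u s x - v s x"
  have wL: "w1 \<in> L2 \<Omega>" "w2 \<in> L2 \<Omega>"
    using u v by (auto simp: L2_has_right_derivative_def)
  have "((\<lambda>h. L2_norm_on \<Omega> (?e ?uv (\<lambda>x. w1 x - w2 x) h)) \<longlongrightarrow> 0) (at_right 0)"
  proof (rule tendsto_sandwich[OF _ _ tendsto_const])
    show "((\<lambda>h. L2_norm_on \<Omega> (?e u w1 h) + L2_norm_on \<Omega> (?e v w2 h)) \<longlongrightarrow> 0) (at_right 0)"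
      using u v by (auto simp: L2_has_right_derivative_def intro: tendsto_add_zero)
    show "\<forall>\<^sub>F h in at_right 0. L2_norm_on \<Omega> (?e ?uv (\<lambda>x. w1 x - w2 x) h)
            \<le> L2_norm_on \<Omega> (?e u w1 h) + L2_norm_on \<Omega> (?e v w2 h)"
      using eventually_at_right_less[of "0::real"]
    proof eventually_elim
      case (elim h)
      have "?e ?uv (\<lambda>x. w1 x - w2 x) h = (\<lambda>x. ?e u w1 h x - ?e v w2 h x)"
        by (simp add: fun_eq_iff diff_divide_distrib)
      then show ?case
        using elim by (simp only:) (intro L2_norm_on_triangle_diff L2_diff L2_divide uL vL wL; simp)
    qed
  qed simp
  then show ?thesis
    using wL by (simp add: L2_has_right_derivative_def L2_diff)
qed

text \<open>
  The squared distance of two solutions is nonincreasing on \<open>[a, \<infinity>)\<close> for every \<open>a > 0\<close>. At time \<open>0\<close>, where no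
  derivative is available, continuity takes over.
\<close>

theorem neumann_flow_unique:
  assumes u: "neumann_flow_solution \<Omega> u\<^sub>0 u" and v: "neumann_flow_solution \<Omega> u\<^sub>0 v" and t: "0 \<le> t"
  shows "AE x in lebesgue_on \<Omega>. u t x = v t x"
proof -
  define D where "D s = (\<lambda>x. u s x - v s x)" for s
  define N where "N s = L2_norm_on \<Omega> (D s)" for s
  have uL: "u s \<in> L2 \<Omega>" and vL: "v s \<in> L2 \<Omega>" if "0 \<le> s" for s
    using u v that by (auto simp: neumann_flow_solution_def)
  then have DL: "D s \<in> L2 \<Omega>" if "0 \<le> s" for s
    using that unfolding D_def by (intro L2_diff)
  have contN: "continuous_on {0..} N"
    unfolding continuous_on_def
  proof
    fix s :: real assume "s \<in> {0..}"
    then have s: "0 \<le> s" by simp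
    let ?B = "\<lambda>r. L2_norm_on \<Omega> (\<lambda>x. u r x - u s x) + L2_norm_on \<Omega> (\<lambda>x. v r x - v s x)"
    have "(?B \<longlongrightarrow> 0) (at s within {0..})"
      using u v s by (auto simp: neumann_flow_solution_def intro!: tendsto_add_zero)
    moreover have "\<forall>\<^sub>F r in at s within {0..}. norm (N r - N s) \<le> ?B r"
      unfolding eventually_at_filter
    proof (intro always_eventually allI impI)
      fix r :: real assume "r \<in> {0..}"
      then have r: "0 \<le> r" by simp
      have "\<bar>N r - N s\<bar> \<le> L2_norm_on \<Omega> (\<lambda>x. D r x - D s x)"
        unfolding N_def by (intro L2_norm_on_reverse_triangle DL r s)
      also have "(\<lambda>x. D r x - D s x) = (\<lambda>x. (u r x - u s x) - (v r x - v s x))"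
        by (auto simp: D_def)
      also have "L2_norm_on \<Omega> \<dots> \<le> ?B r"
        by (intro L2_norm_on_triangle_diff L2_diff uL vL r s)
      finally show "norm (N r - N s) \<le> ?B r" by simp
    qed
    ultimately have "((\<lambda>r. N r - N s) \<longlongrightarrow> 0) (at s within {0..})"
      by (rule Lim_null_comparison[rotated])
    then show "(N \<longlongrightarrow> N s) (at s within {0..})"
      by (simp add: Lim_null[of N])
  qed
  have dec: "(N b)\<^sup>2 \<le> (N a)\<^sup>2" if ab: "0 < a" "a \<le> b" for a b
  proof (rule nonincreasing_if_right_Dini_nonpos[OF ab(2)])
    show "continuous_on {a..b} (\<lambda>s. (N s)\<^sup>2)"
      using ab by (intro continuous_intros continuous_on_subset[OF contN]) auto
    fix r \<epsilon> :: real assume r: "a \<le> r" "r < b" and \<epsilon>: "0 < \<epsilon>"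
    with ab have r0: "0 < r" by simp
    obtain w1 where w1: "L2_has_right_derivative \<Omega> u w1 r"
        "(\<lambda>x. - w1 x) \<in> L2_subdifferential \<Omega> (\<Phi>\<^sub>0 \<Omega>) (u r)"
      using u r0 unfolding neumann_flow_solution_def by blast
    obtain w2 where w2: "L2_has_right_derivative \<Omega> v w2 r"
        "(\<lambda>x. - w2 x) \<in> L2_subdifferential \<Omega> (\<Phi>\<^sub>0 \<Omega>) (v r)"
      using v r0 unfolding neumann_flow_solution_def by blast
    have "0 \<le> L2_inner \<Omega> (D r) (\<lambda>x. - w1 x - - w2 x)"
      unfolding D_def by (rule subdifferential_monotone[OF w1(2) w2(2)]) (rule \<Phi>\<^sub>0_nonneg)+
    also have "\<dots> = - L2_inner \<Omega> (D r) (\<lambda>x. w1 x - w2 x)"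
      by (simp add: L2_inner_commute[of \<Omega> "D r"] flip: L2_inner_minus_left)
    finally have "L2_inner \<Omega> (D r) (\<lambda>x. w1 x - w2 x) \<le> 0" by simp
    moreover have "L2_has_right_derivative \<Omega> D (\<lambda>x. w1 x - w2 x) r"
      unfolding D_def using r0
      by (intro L2_has_right_derivative_diff w1(1) w2(1)) (auto intro!: uL vL)
    ultimately show "\<forall>\<^sub>F h in at_right 0. (N (r + h))\<^sup>2 - (N r)\<^sup>2 \<le> \<epsilon> * h"
      unfolding N_def using \<epsilon> r0 by (intro right_difference_quotient_le) (auto intro: DL)
  qed
  have N0: "N 0 = 0"
    unfolding N_def
  proof (rule L2_norm_on_cong_AE_0)
    show "D 0 \<in> borel_measurable (lebesgue_on \<Omega>)" using DL L2_measurable by blast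
    have "AE x in lebesgue_on \<Omega>. u 0 x = u\<^sub>0 x" "AE x in lebesgue_on \<Omega>. v 0 x = u\<^sub>0 x"
      using u v by (auto simp: neumann_flow_solution_def)
    then show "AE x in lebesgue_on \<Omega>. D 0 x = 0"
      by eventually_elim (simp add: D_def)
  qed
  have "N t = 0"
  proof (cases "t = 0")
    case False
    with t have t0: "0 < t" by simp
    have "(N \<longlongrightarrow> N 0) (at 0 within {0..})"
      using contN by (auto simp: continuous_on_def)
    then have "(N \<longlongrightarrow> N 0) (at_right 0)"
      by (rule tendsto_within_subset) auto
    then have lim: "((\<lambda>a. (N a)\<^sup>2) \<longlongrightarrow> 0\<^sup>2) (at_right 0)"
      unfolding N0 by (intro tendsto_intros)
    have "\<forall>\<^sub>F a in at_right 0. a < t"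
      using t0 by (intro order_tendstoD[OF tendsto_ident_at]) auto
    with eventually_at_right_less[of "0::real"] have "\<forall>\<^sub>F a in at_right 0. (N t)\<^sup>2 \<le> (N a)\<^sup>2"
      by eventually_elim (auto intro: dec)
    then have "(N t)\<^sup>2 \<le> 0\<^sup>2"
      using lim by (intro tendsto_lowerbound[OF lim]) auto
    then show ?thesis by simp
  qed (simp add: N0)
  then have "AE x in lebesgue_on \<Omega>. D t x = 0"
    unfolding N_def by (intro L2_norm_on_eq_0_imp_AE DL t)
  then show ?thesis by (simp add: D_def)
qed

section \<open>The divergence theorem on squares\<close>

lemma open_square_eq_box: "open_square r = box (vec (- r)) (vec r)"
  by (auto simp: open_square_def mem_box_cart forall_2)

lemma open_square_lmeasurable [simp]: "open_square r \<in> lmeasurable"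
  by (simp add: open_square_eq_box lmeasurable_box)

lemma open_square_sets [simp]: "open_square r \<in> sets lebesgue"
  using open_square_lmeasurable by (rule fmeasurableD)

lemma measure_open_square: "0 \<le> r \<Longrightarrow> measure lebesgue (open_square r) = 4 * r\<^sup>2"
proof -
  assume r: "0 \<le> r"
  have "measure lebesgue (open_square r) = measure lborel (cbox (vec (- r)) (vec r :: real^2))"
    by (simp add: open_square_eq_box measure_completion measure_lborel_box_eq measure_lborel_cbox_eq)
  also have "\<dots> = (\<Prod>i\<in>(UNIV::2 set). r - - r)"
    using r by (subst content_cbox_cart) (auto simp: interval_eq_empty_cart)
  finally show ?thesis by (simp add: UNIV_2 power2_eq_square)
qed

lemma AE_not_negligible:
  assumes "negligible N" "S \<in> sets lebesgue"
  shows "AE x in lebesgue_on S. x \<notin> N"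
proof -
  have "AE x in lebesgue. x \<notin> N"
    using assms(1) by (simp add: negligible_iff_null_sets AE_not_in)
  then show ?thesis
    using assms(2) by (simp add: AE_restrict_space_iff) (auto elim: eventually_mono)
qed

text \<open>
  The point with given coordinates, built from linear operations so that continuity and derivatives
  are found by the standard rules.
\<close>

definition pt :: "real \<Rightarrow> real \<Rightarrow> real^2" where
  "pt s t = s *\<^sub>R axis 1 1 + t *\<^sub>R axis 2 1"

lemma pt_nth [simp]: "pt s t $ 1 = s" "pt s t $ 2 = t"
  by (simp_all add: pt_def axis_def)

lemma pt_eta [simp]: "pt (x $ 1) (x $ 2) = x"
  by (simp add: vec_eq_iff forall_2)

lemma continuous_on_pt [continuous_intros]:
  "continuous_on S f \<Longrightarrow> continuous_on S g \<Longrightarrow> continuous_on S (\<lambda>x. pt (f x) (g x))"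
  unfolding pt_def by (intro continuous_intros)

text \<open>
  Fubini's theorem is transported from \<open>\<real> \<times> \<real>\<close> to \<open>\<real>\<^sup>2\<close> along the volume preserving coordinate
  bijection, which maps boxes to boxes.
\<close>

lemma integral_square_iterated:
  fixes f :: "real^2 \<Rightarrow> real"
  assumes f: "continuous_on UNIV f"
  shows "integral (cbox (vec a) (vec b)) f = integral {a..b} (\<lambda>s. integral {a..b} (\<lambda>t. f (pt s t)))"
proof -
  define g where "g p = pt (fst p) (snd p)" for p
  define h :: "real^2 \<Rightarrow> real \<times> real" where "h x = (x $ 1, x $ 2)" for x
  have hg: "h (g p) = p" and gh: "g (h x) = x" for p x
    by (simp_all add: g_def h_def)
  have g_box: "g ` cbox u v = cbox (g u) (g v)" for u v
  proof -
    have "x \<in> g ` cbox u v \<longleftrightarrow> h x \<in> cbox u v" for x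
      using hg gh by (metis image_iff)
    then show ?thesis
      by (cases u; cases v) (auto simp: cbox_Pair_eq mem_box_cart forall_2 g_def h_def)
  qed
  have h_box: "h ` cbox u v = cbox (h u) (h v)" for u v
  proof -
    have "h ` cbox u v = h ` g ` cbox (h u) (h v)" by (simp add: g_box gh)
    then show ?thesis by (simp add: image_image hg)
  qed
  have content_g: "measure lborel (g ` cbox u v) = 1 * measure lborel (cbox u v)" for u v
  proof (cases "cbox u v = {}")
    case False
    then have "cbox (g u) (g v) \<noteq> {}" by (simp flip: g_box)
    moreover obtain u1 u2 v1 v2 where uv: "u = (u1, u2)" "v = (v1, v2)" by (cases u; cases v)
    moreover have "u1 \<le> v1" "u2 \<le> v2" using False uv by (auto simp: cbox_Pair_eq)
    ultimately show ?thesis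
      unfolding g_box by (simp add: content_cbox_cart UNIV_2 content_Pair g_def)
  qed simp
  have "(f has_integral integral (cbox (vec a) (vec b)) f) (cbox (vec a) (vec b))"
    by (intro integrable_integral integrable_continuous continuous_on_subset[OF f]) simp
  note f_int = this
  have cont_g: "continuous (at p) g" for p
    unfolding g_def pt_def by (intro continuous_intros)
  have "((\<lambda>p. f (g p)) has_integral (1 / 1) *\<^sub>R integral (cbox (vec a) (vec b)) f) (h ` cbox (vec a) (vec b))"
    using has_integral_twiddle[OF _ hg gh cont_g _ _ content_g f_int] g_box h_box zero_less_one by blast
  moreover have "h ` cbox (vec a) (vec b) = cbox (a, a) (b, b)"
    by (simp add: h_box) (simp add: h_def)
  ultimately have "integral (cbox (vec a) (vec b)) f = integral (cbox (a, a) (b, b)) (\<lambda>p. f (g p))"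
    by (simp add: integral_unique)
  also have "\<dots> = integral (cbox a b) (\<lambda>s. integral (cbox a b) (\<lambda>t. f (g (s, t))))"
    unfolding g_def
    by (intro integral_prod_continuous continuous_on_compose2[OF f] continuous_intros) auto
  finally show ?thesis by (simp add: g_def cbox_interval)
qed

lemma integral_square_iterated':
  fixes f :: "real^2 \<Rightarrow> real"
  assumes f: "continuous_on UNIV f"
  shows "integral (cbox (vec a) (vec b)) f = integral {a..b} (\<lambda>t. integral {a..b} (\<lambda>s. f (pt s t)))"
proof -
  have "continuous_on (cbox (a, a) (b, b)) (\<lambda>(s, t). f (pt s t))"
    unfolding case_prod_beta by (intro continuous_on_compose2[OF f] continuous_intros) auto
  from integral_swap_continuous[OF this] show ?thesis
    unfolding integral_square_iterated[OF f] by (simp add: cbox_interval)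
qed

lemma divergence_eq:
  assumes "(z has_derivative blinfun_apply (z' x)) (at x)"
  shows "divergence z x = z' x (axis 1 1) $ 1 + z' x (axis 2 1) $ 2"
  using frechet_derivative_at[OF assms] by (simp add: divergence_def sum_2)

lemma integral_divergence_square:
  fixes z :: "real^2 \<Rightarrow> real^2"
  assumes der: "\<And>x. (z has_derivative blinfun_apply (z' x)) (at x)" and cont: "continuous_on UNIV z'"
    and r: "0 \<le> r"
  shows "integral (cbox (vec (- r)) (vec r)) (divergence z)
         = integral {- r..r} (\<lambda>t. z (pt r t) $ 1 - z (pt (- r) t) $ 1)
         + integral {- r..r} (\<lambda>s. z (pt s r) $ 2 - z (pt s (- r)) $ 2)"
proof -
  define d where "d i x = z' x (axis i 1) $ i" for i x
  have cd: "continuous_on UNIV (d i)" for i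
    unfolding d_def by (intro continuous_intros cont)
  have "divergence z = (\<lambda>x. d 1 x + d 2 x)"
    unfolding d_def by (rule ext, rule divergence_eq[where z' = z', OF der])
  then have "integral (cbox (vec (- r)) (vec r)) (divergence z)
      = integral (cbox (vec (- r)) (vec r)) (d 1) + integral (cbox (vec (- r)) (vec r)) (d 2)"
    by (simp add: integral_add integrable_continuous continuous_on_subset[OF cd])
  moreover have "integral {- r..r} (\<lambda>s. d 1 (pt s t)) = z (pt r t) $ 1 - z (pt (- r) t) $ 1" for t
  proof -
    have "((\<lambda>s. z (pt s t) $ 1) has_derivative (\<lambda>h. h * d 1 (pt s t))) (at s)" for s
    proof -
      have "((\<lambda>s. pt s t) has_derivative (\<lambda>h. h *\<^sub>R axis 1 1)) (at s)"
        unfolding pt_def by (auto intro!: derivative_eq_intros)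
      from has_derivative_compose[OF this der[of "pt s t"]]
      have "((\<lambda>s. z (pt s t)) has_derivative (\<lambda>h. z' (pt s t) (h *\<^sub>R axis 1 1))) (at s)" .
      from bounded_linear.has_derivative[OF bounded_linear_vec_nth this, of 1]
      show ?thesis by (simp add: d_def blinfun.scaleR_right)
    qed
    then have "((\<lambda>s. z (pt s t) $ 1) has_vector_derivative d 1 (pt s t)) (at s within {- r..r})" for s
      by (auto simp: has_vector_derivative_def intro: has_derivative_at_withinI)
    then show ?thesis
      using r by (intro integral_unique fundamental_theorem_of_calculus) auto
  qed
  moreover have "integral {- r..r} (\<lambda>t. d 2 (pt s t)) = z (pt s r) $ 2 - z (pt s (- r)) $ 2" for s
  proof -
    have "((\<lambda>t. z (pt s t) $ 2) has_derivative (\<lambda>h. h * d 2 (pt s t))) (at t)" for t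
    proof -
      have "((\<lambda>t. pt s t) has_derivative (\<lambda>h. h *\<^sub>R axis 2 1)) (at t)"
        unfolding pt_def by (auto intro!: derivative_eq_intros)
      from has_derivative_compose[OF this der[of "pt s t"]]
      have "((\<lambda>t. z (pt s t)) has_derivative (\<lambda>h. z' (pt s t) (h *\<^sub>R axis 2 1))) (at t)" .
      from bounded_linear.has_derivative[OF bounded_linear_vec_nth this, of 2]
      show ?thesis by (simp add: d_def blinfun.scaleR_right)
    qed
    then have "((\<lambda>t. z (pt s t) $ 2) has_vector_derivative d 2 (pt s t)) (at t within {- r..r})" for t
      by (auto simp: has_vector_derivative_def intro: has_derivative_at_withinI)
    then show ?thesis
      using r by (intro integral_unique fundamental_theorem_of_calculus) auto
  qed
  ultimately show ?thesis
    by (simp add: integral_square_iterated[OF cd[of 2]] integral_square_iterated'[OF cd[of 1]])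
qed

lemma Cc1E:
  assumes "z \<in> Cc1 \<Omega>"
  obtains z' :: "real^2 \<Rightarrow> (real^2) \<Rightarrow>\<^sub>L (real^2)"
  where "\<And>x. (z has_derivative blinfun_apply (z' x)) (at x)" "continuous_on UNIV z'"
    "continuous_on UNIV (divergence z)" "continuous_on UNIV z" "\<And>x. x \<notin> \<Omega> \<Longrightarrow> z x = 0"
proof -
  obtain z' :: "real^2 \<Rightarrow> (real^2) \<Rightarrow>\<^sub>L (real^2)" where
    z': "\<And>x. (z has_derivative blinfun_apply (z' x)) (at x)" "continuous_on UNIV z'"
    using assms by (auto simp: Cc1_def)
  have "divergence z = (\<lambda>x. z' x (axis 1 1) $ 1 + z' x (axis 2 1) $ 2)"
    by (rule ext, rule divergence_eq[where z' = z', OF z'(1)])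
  then have "continuous_on UNIV (divergence z)"
    by (auto intro!: continuous_intros z'(2))
  moreover have "continuous_on UNIV z"
    by (intro continuous_at_imp_continuous_on ballI has_derivative_continuous[OF z'(1)])
  moreover have "z x = 0" if "x \<notin> \<Omega>" for x
    using assms that closure_subset[of "{x. z x \<noteq> 0}"] by (auto simp: Cc1_def)
  ultimately show ?thesis using that z' by blast
qed

lemma integrable_open_square_if_continuous:
  fixes f :: "real^2 \<Rightarrow> real"
  assumes f: "continuous_on UNIV f"
  shows "integrable (lebesgue_on (open_square r)) f"
proof -
  have "integrable (lebesgue_on (cbox (vec (- r)) (vec r))) f"
    by (intro continuous_imp_integrable continuous_on_subset[OF f]) simp
  then show ?thesis
    using set_integrable_subset[of lebesgue "cbox (vec (- r)) (vec r)" f "open_square r"]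
      box_subset_cbox[of "vec (- r) :: real^2" "vec r"]
    by (simp add: set_integrable_def integrable_restrict_space open_square_eq_box)
qed

lemma lebesgue_integral_open_square:
  fixes f :: "real^2 \<Rightarrow> real"
  assumes f: "continuous_on UNIV f"
  shows "(LINT x|lebesgue_on (open_square r). f x) = integral (cbox (vec (- r)) (vec r)) f"
  using lebesgue_integral_eq_integral[OF integrable_open_square_if_continuous[OF f]]
  by (simp add: open_square_eq_box integral_open_interval)

lemma integral_divergence_eq_0:
  assumes z: "z \<in> Cc1 (open_square L)" and L: "0 \<le> L"
  shows "(LINT x|lebesgue_on (open_square L). divergence z x) = 0"
proof (rule Cc1E[OF z])
  fix z' :: "real^2 \<Rightarrow> (real^2) \<Rightarrow>\<^sub>L (real^2)"
  assume z': "\<And>x. (z has_derivative blinfun_apply (z' x)) (at x)" "continuous_on UNIV z'"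
    "continuous_on UNIV (divergence z)" "\<And>x. x \<notin> open_square L \<Longrightarrow> z x = 0"
  have "z (pt s t) = 0" if "\<bar>s\<bar> = L \<or> \<bar>t\<bar> = L" for s t
    using that by (intro z'(4)) (auto simp: open_square_def)
  then show ?thesis
    using L by (simp add: lebesgue_integral_open_square[OF z'(3)] integral_divergence_square[OF z'(1,2) L])
qed

text \<open>
  The flux through each of the four sides is at most the side length \<open>2 r\<close>.
\<close>

lemma abs_integral_divergence_le:
  assumes z: "z \<in> Cc1 \<Omega>" and bound: "\<And>x. max \<bar>z x $ 1\<bar> \<bar>z x $ 2\<bar> \<le> 1" and r: "0 \<le> r"
  shows "\<bar>LINT x|lebesgue_on (open_square r). divergence z x\<bar> \<le> 8 * r"
proof (rule Cc1E[OF z])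
  fix z' :: "real^2 \<Rightarrow> (real^2) \<Rightarrow>\<^sub>L (real^2)"
  assume z': "\<And>x. (z has_derivative blinfun_apply (z' x)) (at x)" "continuous_on UNIV z'"
    "continuous_on UNIV (divergence z)" "continuous_on UNIV z"
  have b: "\<bar>z x $ 1\<bar> \<le> 1" "\<bar>z x $ 2\<bar> \<le> 1" for x using bound[of x] by auto
  have diff: "\<bar>p - q\<bar> \<le> 2" if "\<bar>p\<bar> \<le> 1" "\<bar>q\<bar> \<le> 1" for p q :: real
    using that by linarith
  have "norm (integral {- r..r} (\<lambda>t. z (pt r t) $ 1 - z (pt (- r) t) $ 1)) \<le> 2 * (r - - r)"
    using r by (intro integral_bound) (auto intro!: continuous_intros continuous_on_compose2[OF z'(4)] diff b)
  moreover have "norm (integral {- r..r} (\<lambda>s. z (pt s r) $ 2 - z (pt s (- r)) $ 2)) \<le> 2 * (r - - r)"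
    using r by (intro integral_bound) (auto intro!: continuous_intros continuous_on_compose2[OF z'(4)] diff b)
  ultimately show ?thesis
    by (simp add: lebesgue_integral_open_square[OF z'(3)] integral_divergence_square[OF z'(1,2) r])
qed

lemma open_square_mono: "r \<le> R \<Longrightarrow> open_square r \<subseteq> open_square R"
  by (auto simp: open_square_def)

lemma lebesgue_integral_open_square_indicator:
  fixes f :: "real^2 \<Rightarrow> real"
  assumes "r \<le> R"
  shows "(LINT x|lebesgue_on (open_square R). indicator (open_square r) x * f x)
         = (LINT x|lebesgue_on (open_square r). f x)"
proof -
  have "(\<lambda>x. indicator (open_square R) x *\<^sub>R (indicator (open_square r) x * f x))
        = (\<lambda>x. indicator (open_square r) x *\<^sub>R f x)"
    using open_square_mono[OF assms] by (force simp: indicator_def)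
  then show ?thesis by (simp add: integral_restrict_space)
qed

lemma integrable_open_square_const [simp]: "integrable (lebesgue_on (open_square r)) (\<lambda>x. c::real)"
  by (rule integrable_open_square_if_continuous) simp

lemma integrable_open_square_indicator_mult:
  fixes f :: "real^2 \<Rightarrow> real"
  assumes "integrable (lebesgue_on (open_square R)) f"
  shows "integrable (lebesgue_on (open_square R)) (\<lambda>x. indicator (open_square r) x * f x)"
proof -
  have "open_square r \<inter> open_square R \<in> sets (lebesgue_on (open_square R))"
    unfolding sets_restrict_space by (intro image_eqI[of _ _ "open_square r"]) (simp_all add: Int_commute)
  from integrable_mult_indicator[OF this assms]
  have "integrable (lebesgue_on (open_square R)) (\<lambda>x. indicator (open_square r \<inter> open_square R) x * f x)"
    by simp
  then show ?thesis
    by (rule Bochner_Integration.integrable_cong[THEN iffD1, rotated -1]) (auto simp: indicator_def)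
qed

section \<open>Functions with one value in a square and another one outside\<close>

definition two_level :: "real \<Rightarrow> real \<Rightarrow> real \<Rightarrow> real^2 \<Rightarrow> real" where
  "two_level \<alpha> p q x = (if x \<in> open_square \<alpha> then p else q)"

lemma two_level_eq: "two_level \<alpha> p q x = q - indicator (open_square \<alpha>) x * (q - p)"
  by (simp add: two_level_def indicator_def)

lemma integrable_two_level: "integrable (lebesgue_on (open_square L)) (two_level \<alpha> p q)"
  unfolding two_level_eq [abs_def]
  by (intro Bochner_Integration.integrable_diff integrable_open_square_indicator_mult) auto

lemma two_level_L2: "two_level \<alpha> p q \<in> L2 (open_square L)"
proof -
  have "(\<lambda>x. (two_level \<alpha> p q x)\<^sup>2) = two_level \<alpha> (p\<^sup>2) (q\<^sup>2)"
    by (auto simp: two_level_def)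
  then show ?thesis
    using borel_measurable_integrable[OF integrable_two_level] by (simp add: L2_def integrable_two_level)
qed

lemma integral_two_level:
  assumes "0 \<le> \<alpha>" "\<alpha> \<le> L"
  shows "(LINT x|lebesgue_on (open_square L). two_level \<alpha> p q x) = 4 * \<alpha>\<^sup>2 * p + 4 * (L\<^sup>2 - \<alpha>\<^sup>2) * q"
proof -
  have const: "(LINT x|lebesgue_on (open_square r). c) = 4 * r\<^sup>2 * c" if "0 \<le> r" for r c :: real
    using that by (simp add: measure_restrict_space measure_open_square)
  have "(LINT x|lebesgue_on (open_square L). two_level \<alpha> p q x)
      = (LINT x|lebesgue_on (open_square L). q)
        - (LINT x|lebesgue_on (open_square L). indicator (open_square \<alpha>) x * (q - p))"
    unfolding two_level_eq
    by (intro Bochner_Integration.integral_diff integrable_open_square_indicator_mult) auto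
  also have "\<dots> = 4 * L\<^sup>2 * q - 4 * \<alpha>\<^sup>2 * (q - p)"
    unfolding lebesgue_integral_open_square_indicator[OF assms(2)] using assms by (simp only: const)
  finally show ?thesis by (simp add: algebra_simps)
qed

lemma L2_inner_two_level:
  assumes "0 \<le> \<alpha>" "\<alpha> \<le> L"
  shows "L2_inner (open_square L) (two_level \<alpha> a b) (two_level \<alpha> p q)
         = 4 * \<alpha>\<^sup>2 * (a * p) + 4 * (L\<^sup>2 - \<alpha>\<^sup>2) * (b * q)"
proof -
  have "(\<lambda>x. two_level \<alpha> a b x * two_level \<alpha> p q x) = two_level \<alpha> (a * p) (b * q)"
    by (auto simp: two_level_def)
  then show ?thesis by (simp add: L2_inner_def integral_two_level[OF assms])
qed

text \<open>
  The constant \<open>q\<close> contributes nothing, since test fields vanish near the boundary of the large square.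
  What remains is the flux through the boundary of the small one, of length \<open>8 \<alpha>\<close>.
\<close>

lemma \<Phi>\<^sub>0_two_level_le:
  assumes "0 \<le> \<alpha>" "\<alpha> \<le> L" "p \<le> q"
  shows "\<Phi>\<^sub>0 (open_square L) (two_level \<alpha> p q) \<le> ereal (8 * \<alpha> * (q - p))"
  unfolding \<Phi>\<^sub>0_def
proof (rule SUP_least)
  fix z assume "z \<in> {z \<in> Cc1 (open_square L). \<forall>x. max \<bar>z x $ 1\<bar> \<bar>z x $ 2\<bar> \<le> 1}"
  then have z: "z \<in> Cc1 (open_square L)" and bound: "\<And>x. max \<bar>z x $ 1\<bar> \<bar>z x $ 2\<bar> \<le> 1" by auto
  have "continuous_on UNIV (divergence z)" using Cc1E[OF z] by blast
  then have int: "integrable (lebesgue_on (open_square L)) (divergence z)"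
    by (rule integrable_open_square_if_continuous)
  have "(\<lambda>x. two_level \<alpha> p q x * divergence z x)
      = (\<lambda>x. q * divergence z x - (q - p) * (indicator (open_square \<alpha>) x * divergence z x))"
    by (auto simp: two_level_eq algebra_simps)
  then have "(LINT x|lebesgue_on (open_square L). two_level \<alpha> p q x * divergence z x)
      = q * (LINT x|lebesgue_on (open_square L). divergence z x)
        - (q - p) * (LINT x|lebesgue_on (open_square L). indicator (open_square \<alpha>) x * divergence z x)"
    by (simp add: int integrable_open_square_indicator_mult)
  also have "\<dots> = - ((q - p) * (LINT x|lebesgue_on (open_square \<alpha>). divergence z x))"
    using assms by (simp add: integral_divergence_eq_0[OF z] lebesgue_integral_open_square_indicator)
  also have "\<dots> \<le> \<bar>(q - p) * (LINT x|lebesgue_on (open_square \<alpha>). divergence z x)\<bar>"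
    by (rule abs_ge_minus_self)
  also have "\<dots> \<le> (q - p) * (8 * \<alpha>)"
    using abs_integral_divergence_le[OF z bound assms(1)] assms by (simp add: abs_mult mult_left_mono)
  finally show "ereal (LINT x|lebesgue_on (open_square L). two_level \<alpha> p q x * divergence z x)
      \<le> ereal (8 * \<alpha> * (q - p))"
    by (simp add: mult.commute)
qed

section \<open>Smooth fields of product form as calibrations\<close>

text \<open>
  Both components vanish as soon as one of the coordinates leaves \<open>(- r, r)\<close>: this is why \<open>h\<close> and \<open>k\<close>
  are both required to have compact support.
\<close>

lemma tensor_field:
  fixes h k h' k' :: "real \<Rightarrow> real"
  assumes h: "\<And>s. (h has_real_derivative h' s) (at s)" "continuous_on UNIV h'"
    and k: "\<And>s. (k has_real_derivative k' s) (at s)" "continuous_on UNIV k'"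
    and supp: "\<And>s. r \<le> \<bar>s\<bar> \<Longrightarrow> h s = 0" "\<And>s. r \<le> \<bar>s\<bar> \<Longrightarrow> k s = 0" and r: "r < L"
  defines "z \<equiv> \<lambda>x. pt (- (k (x $ 2) * h (x $ 1))) (- (k (x $ 1) * h (x $ 2)))"
  shows "z \<in> Cc1 (open_square L)"
    and "divergence z x = - (k (x $ 2) * h' (x $ 1) + k (x $ 1) * h' (x $ 2))"
proof -
  define D where "D x d = pt (- (k (x $ 2) * (d $ 1 * h' (x $ 1)) + d $ 2 * k' (x $ 2) * h (x $ 1)))
      (- (k (x $ 1) * (d $ 2 * h' (x $ 2)) + d $ 1 * k' (x $ 1) * h (x $ 2)))" for x d :: "real^2"
  have comp: "((\<lambda>x::real^2. f (x $ i)) has_derivative (\<lambda>d. d $ i * f' (x $ i))) (at x)"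
    if "\<And>s. (f has_real_derivative f' s) (at s)" for f f' :: "real \<Rightarrow> real" and i x
    using that by (intro DERIV_compose_FDERIV bounded_linear_imp_has_derivative bounded_linear_vec_nth)
  have der: "(z has_derivative D x) (at x)" for x
    unfolding z_def pt_def
    by (rule has_derivative_eq_rhs,
        (rule derivative_intros comp[OF h(1)] comp[OF k(1)])+)
      (auto simp: D_def pt_def fun_eq_iff)
  define z' where "z' x = Blinfun (D x)" for x
  have z': "blinfun_apply (z' x) = D x" for x
    unfolding z'_def by (rule bounded_linear_Blinfun_apply[OF has_derivative_bounded_linear[OF der]])
  have ch: "continuous_on UNIV h" "continuous_on UNIV k"
    using h(1) k(1) by (auto intro!: DERIV_continuous_on)
  have cc: "continuous_on UNIV (\<lambda>x::real^2. f (x $ i))" if "continuous_on UNIV f" for f :: "real \<Rightarrow> real" and i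
    by (rule continuous_on_compose2[OF that]) (auto intro!: continuous_intros)
  have cont: "continuous_on UNIV z'"
    unfolding continuous_on_eq_continuous_within
  proof (intro ballI continuous_blinfun_componentwiseI1)
    fix x i :: "real^2"
    have "continuous_on UNIV (\<lambda>x. z' x i)"
      unfolding z' D_def by (intro continuous_intros cc ch h(2) k(2))
    then show "continuous (at x) (\<lambda>x. z' x i)"
      by (simp add: continuous_on_eq_continuous_at)
  qed
  have "{x. z x \<noteq> 0} \<subseteq> cbox (vec (- r)) (vec r)"
  proof
    fix x assume "x \<in> {x. z x \<noteq> 0}"
    then have "k (x $ 2) * h (x $ 1) \<noteq> 0 \<or> k (x $ 1) * h (x $ 2) \<noteq> 0"
      by (auto simp: z_def pt_def)
    then have "\<bar>x $ 1\<bar> < r \<and> \<bar>x $ 2\<bar> < r"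
      using supp by (metis mult_eq_0_iff not_le)
    then show "x \<in> cbox (vec (- r)) (vec r)"
      by (auto simp: mem_box_cart forall_2)
  qed
  then have cl: "closure {x. z x \<noteq> 0} \<subseteq> cbox (vec (- r)) (vec r)"
    by (rule closure_minimal) (rule closed_cbox)
  moreover have "cbox (vec (- r)) (vec r) \<subseteq> open_square L"
  proof
    fix x :: "real^2" assume "x \<in> cbox (vec (- r)) (vec r)"
    then show "x \<in> open_square L"
      using r unfolding open_square_def mem_box_cart forall_2 by auto
  qed
  moreover have "compact (closure {x. z x \<noteq> 0})"
    using bounded_subset[OF bounded_cbox cl] by (auto simp: compact_eq_bounded_closed)
  ultimately show "z \<in> Cc1 (open_square L)"
    using der cont unfolding Cc1_def by (auto simp flip: z' intro!: exI[of _ z'])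
  have "divergence z x = D x (axis 1 1) $ 1 + D x (axis 2 1) $ 2"
    using divergence_eq[of z z' x] der by (simp add: z')
  also have "\<dots> = - (k (x $ 2) * h' (x $ 1) + k (x $ 1) * h' (x $ 2))"
    by (simp add: D_def axis_def)
  finally show "divergence z x = - (k (x $ 2) * h' (x $ 1) + k (x $ 1) * h' (x $ 2))" .
qed

lemma negligible_coordinates_in_finite:
  assumes "finite N"
  shows "negligible {x::real^2. x $ 1 \<in> N \<or> x $ 2 \<in> N}"
proof -
  have "{x::real^2. x $ 1 \<in> N \<or> x $ 2 \<in> N} = (\<Union>c\<in>N. {x. x $ 1 = c} \<union> {x. x $ 2 = c})"
    by auto
  moreover have "negligible {x::real^2. x $ i = c}" for i c
    using negligible_standard_hyperplane[of "axis i 1 :: real^2" c]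
    by (simp add: inner_axis axis_in_Basis_iff)
  ultimately show ?thesis
    using assms by (simp only:) (intro negligible_Union finite_imageI, auto intro: negligible_Un)
qed

text \<open>
  The functions \<open>h\<close>, \<open>k\<close> may converge to profiles that are neither smooth nor compactly supported, and the
  limit of the divergences is still a lower bound for \<open>\<Phi>\<^sub>0\<close>. In the divergence only the
  \<open>h n\<close> are differentiated: their derivatives need a uniform bound for dominated convergence, whereas \<open>K\<close>
  may have jumps. The exceptional coordinates \<open>N\<close> only produce
  finitely many lines, which are null sets.
\<close>

lemma tensor_calibration:
  fixes h k h' k' :: "nat \<Rightarrow> real \<Rightarrow> real"
  assumes h: "\<And>n s. (h n has_real_derivative h' n s) (at s)" "\<And>n. continuous_on UNIV (h' n)"
    and k: "\<And>n s. (k n has_real_derivative k' n s) (at s)" "\<And>n. continuous_on UNIV (k' n)"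
    and h_supp: "\<And>n. \<exists>r<L. \<forall>s. r \<le> \<bar>s\<bar> \<longrightarrow> h n s = 0"
    and k_supp: "\<And>n. \<exists>r<L. \<forall>s. r \<le> \<bar>s\<bar> \<longrightarrow> k n s = 0"
    and bound: "\<And>n s. \<bar>h n s\<bar> \<le> 1" "\<And>n s. \<bar>k n s\<bar> \<le> 1" "\<And>n s. \<bar>h' n s\<bar> \<le> C"
    and N: "finite N"
    and lim: "\<And>s. \<bar>s\<bar> < L \<Longrightarrow> s \<notin> N \<Longrightarrow> (\<lambda>n. h' n s) \<longlonglongrightarrow> H s"
       "\<And>s. \<bar>s\<bar> < L \<Longrightarrow> s \<notin> N \<Longrightarrow> (\<lambda>n. k n s) \<longlonglongrightarrow> K s"
    and w: "w \<in> L2 (open_square L)"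
      "\<And>x. x \<in> open_square L \<Longrightarrow> x $ 1 \<notin> N \<Longrightarrow> x $ 2 \<notin> N \<Longrightarrow>
         w x = - (K (x $ 2) * H (x $ 1) + K (x $ 1) * H (x $ 2))"
    and v: "v \<in> L2 (open_square L)"
  shows "ereal (L2_inner (open_square L) w v) \<le> \<Phi>\<^sub>0 (open_square L) v"
proof -
  let ?M = "lebesgue_on (open_square L)"
  define z where "z n x = pt (- (k n (x $ 2) * h n (x $ 1))) (- (k n (x $ 1) * h n (x $ 2)))" for n and x :: "real^2"
  have z: "z n \<in> Cc1 (open_square L)"
    and div: "divergence (z n) x = - (k n (x $ 2) * h' n (x $ 1) + k n (x $ 1) * h' n (x $ 2))" for n x
  proof -
    obtain r1 r2 where r: "r1 < L" "\<And>s. r1 \<le> \<bar>s\<bar> \<Longrightarrow> h n s = 0" "r2 < L" "\<And>s. r2 \<le> \<bar>s\<bar> \<Longrightarrow> k n s = 0"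
      using h_supp[of n] k_supp[of n] by blast
    show "z n \<in> Cc1 (open_square L)"
      "divergence (z n) x = - (k n (x $ 2) * h' n (x $ 1) + k n (x $ 1) * h' n (x $ 2))"
      unfolding z_def
      by (rule tensor_field[OF h(1)[of n] h(2)[of n] k(1)[of n] k(2)[of n], where r = "max r1 r2"]; use r in simp)+
  qed
  have "(\<lambda>n. LINT x|?M. v x * divergence (z n) x) \<longlonglongrightarrow> (LINT x|?M. v x * w x)"
  proof (rule integral_dominated_convergence)
    show "(\<lambda>x. v x * w x) \<in> borel_measurable ?M"
      using L2_integrable_mult[OF v w(1)] by simp
    show "(\<lambda>x. v x * divergence (z n) x) \<in> borel_measurable ?M" for n
    proof -
      have "continuous_on UNIV (divergence (z n))" using Cc1E[OF z] by blast
      then have "divergence (z n) \<in> borel_measurable ?M"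
        by (intro borel_measurable_integrable integrable_open_square_if_continuous)
      then show ?thesis using L2_measurable[OF v] by simp
    qed
    \<comment> \<open>The constant \<open>1\<close> is square integrable, so \<open>v\<close> is integrable.\<close>
    have "two_level 0 1 1 \<in> L2 (open_square L)" by (rule two_level_L2)
    from L2_integrable_mult[OF v this] have "integrable ?M v" by (simp add: two_level_def)
    then show "integrable ?M (\<lambda>x. \<bar>v x\<bar> * (2 * C))" by simp
    have prod: "\<bar>k n s * h' n t\<bar> \<le> C" for n s t
      using mult_mono[OF bound(2)[of n s] bound(3)[of n t]] by (simp add: abs_mult)
    show "AE x in ?M. norm (v x * divergence (z n) x) \<le> \<bar>v x\<bar> * (2 * C)" for n
    proof (rule AE_I2)
      fix x :: "real^2"
      have "\<bar>divergence (z n) x\<bar> \<le> 2 * C"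
        unfolding div using prod[of n "x $ 2" "x $ 1"] prod[of n "x $ 1" "x $ 2"] by linarith
      then show "norm (v x * divergence (z n) x) \<le> \<bar>v x\<bar> * (2 * C)"
        by (simp add: abs_mult mult_left_mono)
    qed
    have "AE x in ?M. x \<notin> {x. x $ 1 \<in> N \<or> x $ 2 \<in> N}"
      by (intro AE_not_negligible negligible_coordinates_in_finite N open_square_sets)
    moreover have "AE x in ?M. x \<in> open_square L"
      using AE_space[of ?M] by (simp add: space_restrict_space)
    ultimately show "AE x in ?M. (\<lambda>n. v x * divergence (z n) x) \<longlonglongrightarrow> v x * w x"
    proof eventually_elim
      case (elim x)
      then show ?case
        unfolding div by (subst w(2)) (auto simp: open_square_def intro!: tendsto_intros lim)
    qed
  qed
  then have "(\<lambda>n. ereal (LINT x|?M. v x * divergence (z n) x)) \<longlonglongrightarrow> ereal (L2_inner (open_square L) w v)"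
    by (simp add: L2_inner_def mult.commute)
  moreover have "ereal (LINT x|?M. v x * divergence (z n) x) \<le> \<Phi>\<^sub>0 (open_square L) v" for n
    unfolding \<Phi>\<^sub>0_def
  proof (rule SUP_upper)
    have "\<bar>k n s * h n t\<bar> \<le> 1" for s t
      using mult_mono[OF bound(2)[of n s] bound(1)[of n t]] by (simp add: abs_mult)
    then show "z n \<in> {z \<in> Cc1 (open_square L). \<forall>x. max \<bar>z x $ 1\<bar> \<bar>z x $ 2\<bar> \<le> 1}"
      using z by (simp add: z_def)
  qed
  ultimately show ?thesis
    by (intro LIMSEQ_le_const2[where a = "\<Phi>\<^sub>0 (open_square L) v"]) blast+
qed

section \<open>One-dimensional profiles\<close>

text \<open>
  Where \<open>f\<close> is flat, the inner function may have a corner. This is the smoothing mechanism for the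
  profiles below.
\<close>

lemma DERIV_compose_zero_Lipschitz:
  fixes f g :: "real \<Rightarrow> real"
  assumes f: "(f has_real_derivative 0) (at (g s))"
    and g: "\<And>r. \<bar>g r - g s\<bar> \<le> B * \<bar>r - s\<bar>"
  shows "((\<lambda>r. f (g r)) has_real_derivative 0) (at s)"
proof -
  obtain c where c: "\<And>y. f y - f (g s) = c y * (y - g s)" "isCont c (g s)" "c (g s) = 0"
    using f unfolding CARAT_DERIV by metis
  have "((\<lambda>r. g r - g s) \<longlongrightarrow> 0) (at s)"
  proof (rule Lim_null_comparison)
    show "((\<lambda>r. B * \<bar>r - s\<bar>) \<longlongrightarrow> 0) (at s)"
      by (auto intro!: tendsto_eq_intros)
  qed (simp add: g)
  then have "(g \<longlongrightarrow> g s) (at s)"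
    by (simp add: Lim_null[of g])
  then have "((\<lambda>r. c (g r)) \<longlongrightarrow> 0) (at s)"
    using isCont_tendsto_compose[OF c(2)] c(3) by metis
  then have lim: "((\<lambda>r. \<bar>c (g r)\<bar> * B) \<longlongrightarrow> 0) (at s)"
    by (auto intro!: tendsto_eq_intros)
  have "((\<lambda>r. (f (g r) - f (g s)) / (r - s)) \<longlongrightarrow> 0) (at s)"
  proof (rule Lim_null_comparison[OF _ lim])
    show "\<forall>\<^sub>F r in at s. norm ((f (g r) - f (g s)) / (r - s)) \<le> \<bar>c (g r)\<bar> * B"
      unfolding eventually_at_filter
    proof (intro always_eventually allI impI)
      fix r :: real assume "r \<noteq> s"
      then have "\<bar>g r - g s\<bar> / \<bar>r - s\<bar> \<le> B"
        using g[of r] by (simp add: pos_divide_le_eq)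
      then have "\<bar>c (g r)\<bar> * (\<bar>g r - g s\<bar> / \<bar>r - s\<bar>) \<le> \<bar>c (g r)\<bar> * B"
        by (rule mult_left_mono) simp
      then show "norm ((f (g r) - f (g s)) / (r - s)) \<le> \<bar>c (g r)\<bar> * B"
        by (simp add: c(1) abs_mult)
    qed
  qed
  then show ?thesis by (simp add: has_field_derivative_iff)
qed

text \<open>
  The derivative of the outer function in the smoothing of the tent: it vanishes near \<open>0\<close> and at \<open>1\<close>,
  the levels of the corners of the tent, and equals \<open>1\<close> on an interval growing to \<open>(0, 1)\<close>
  as \<open>N\<close> tends to infinity.
\<close>

definition trapezoid :: "real \<Rightarrow> real \<Rightarrow> real" where
  "trapezoid N y = max 0 (min 1 (min (N * y - 1) (N * (1 - y))))"

lemma continuous_trapezoid: "continuous_on UNIV (trapezoid N)"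
  unfolding trapezoid_def [abs_def] by (intro continuous_intros)

lemma trapezoid_bounds: "0 \<le> trapezoid N y" "trapezoid N y \<le> 1"
  by (auto simp: trapezoid_def)

lemma trapezoid_0 [simp]: "trapezoid N 0 = 0" and trapezoid_1 [simp]: "trapezoid N 1 = 0"
  by (auto simp: trapezoid_def)

lemma trapezoid_eq_0: "0 < N \<Longrightarrow> y \<le> 1 / N \<Longrightarrow> trapezoid N y = 0"
  by (auto simp: trapezoid_def field_simps)

lemma trapezoid_tendsto:
  assumes "0 < y" "y < 1"
  shows "(\<lambda>n. trapezoid (real (Suc n)) y) \<longlonglongrightarrow> 1"
proof -
  have N: "\<forall>\<^sub>F n in sequentially. c \<le> real (Suc n)" for c
  proof -
    obtain m :: nat where "c \<le> real m" using real_arch_simple by blast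
    then have "c \<le> real (Suc n)" if "m \<le> n" for n using that by simp
    then show ?thesis by (auto simp: eventually_sequentially)
  qed
  have "\<forall>\<^sub>F n in sequentially. trapezoid (real (Suc n)) y = 1"
    using N[of "2 / y"] N[of "1 / (1 - y)"]
  proof eventually_elim
    case (elim n)
    then have "2 \<le> real (Suc n) * y" "1 \<le> real (Suc n) * (1 - y)"
      using assms by (simp_all only: pos_divide_le_eq diff_gt_0_iff_gt)
    then show ?case by (simp add: trapezoid_def)
  qed
  then show ?thesis by (rule tendsto_eventually)
qed

lemma trapezoid_primitive:
  fixes N :: real
  assumes N: "0 < N"
  obtains \<phi> :: "real \<Rightarrow> real"
  where "\<And>y. (\<phi> has_real_derivative trapezoid N y) (at y)"
    and "\<And>y. 0 \<le> y \<Longrightarrow> y \<le> 1 / N \<Longrightarrow> \<phi> y = 0"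
    and "\<And>y. 0 \<le> y \<Longrightarrow> 0 \<le> \<phi> y \<and> \<phi> y \<le> y"
proof -
  have "\<exists>F. \<forall>x::real. - \<infinity> < ereal x \<longrightarrow> ereal x < \<infinity> \<longrightarrow>
      (F has_vector_derivative trapezoid N x) (at x)"
    using continuous_trapezoid by (intro einterval_antiderivative) (auto simp: continuous_on_eq_continuous_at)
  then obtain F where F: "\<And>x. (F has_real_derivative trapezoid N x) (at x)"
    by (auto simp: has_real_derivative_iff_has_vector_derivative)
  define \<phi> where "\<phi> y = F y - F 0" for y
  have der: "(\<phi> has_real_derivative trapezoid N y) (at y)" for y
    unfolding \<phi>_def by (auto intro!: derivative_eq_intros F)
  have mvt: "\<exists>\<xi>. 0 \<le> \<xi> \<and> \<xi> \<le> y \<and> \<phi> y = y * trapezoid N \<xi>" if y: "0 \<le> y" for y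
  proof (cases "y = 0")
    case False
    with y have "0 < y" by simp
    from MVT2[OF this, of \<phi> "trapezoid N"] der
    obtain \<xi> where "0 < \<xi>" "\<xi> < y" "\<phi> y - \<phi> 0 = (y - 0) * trapezoid N \<xi>" by blast
    then show ?thesis by (intro exI[of _ \<xi>]) (simp add: \<phi>_def)
  qed (auto simp: \<phi>_def)
  show ?thesis
  proof (rule that[OF der])
    fix y :: real assume y: "0 \<le> y"
    obtain \<xi> where \<xi>: "0 \<le> \<xi>" "\<xi> \<le> y" "\<phi> y = y * trapezoid N \<xi>" using mvt[OF y] by blast
    show "\<phi> y = 0" if "y \<le> 1 / N"
      using \<xi> that trapezoid_eq_0[OF N, of \<xi>] by simp
    show "0 \<le> \<phi> y \<and> \<phi> y \<le> y"
      using \<xi> y trapezoid_bounds[of N \<xi>] by (simp add: mult_left_le)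
  qed
qed

text \<open>
  The tent rises from \<open>0\<close> at \<open>0\<close> to \<open>1\<close> at \<open>\<alpha>\<close> and falls back to \<open>0\<close> at \<open>L\<close>.
\<close>

definition tent :: "real \<Rightarrow> real \<Rightarrow> real \<Rightarrow> real" where
  "tent \<alpha> L s = max 0 (min (s / \<alpha>) ((L - s) / (L - \<alpha>)))"

context
  fixes \<alpha> L :: real
  assumes \<alpha>: "0 < \<alpha>" and \<alpha>L: "\<alpha> < L"
begin

lemma tent_left: "0 \<le> s \<Longrightarrow> s \<le> \<alpha> \<Longrightarrow> tent \<alpha> L s = s / \<alpha>"
proof -
  assume s: "0 \<le> s" "s \<le> \<alpha>"
  then have "0 \<le> s / \<alpha>" "s / \<alpha> \<le> 1" "1 \<le> (L - s) / (L - \<alpha>)"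
    using \<alpha> \<alpha>L by (simp_all add: le_divide_eq)
  then show ?thesis unfolding tent_def by linarith
qed

lemma tent_right: "\<alpha> \<le> s \<Longrightarrow> s \<le> L \<Longrightarrow> tent \<alpha> L s = (L - s) / (L - \<alpha>)"
proof -
  assume s: "\<alpha> \<le> s" "s \<le> L"
  then have "1 \<le> s / \<alpha>" "(L - s) / (L - \<alpha>) \<le> 1" "0 \<le> (L - s) / (L - \<alpha>)"
    using \<alpha> \<alpha>L by (simp_all add: divide_le_eq)
  then show ?thesis unfolding tent_def by linarith
qed

lemma tent_outside: "s \<le> 0 \<or> L \<le> s \<Longrightarrow> tent \<alpha> L s = 0"
proof -
  assume "s \<le> 0 \<or> L \<le> s"
  then have "s / \<alpha> \<le> 0 \<or> (L - s) / (L - \<alpha>) \<le> 0"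
    using \<alpha> \<alpha>L by (auto simp: divide_le_0_iff)
  then show ?thesis by (auto simp: tent_def)
qed

lemma tent_bounds: "0 \<le> tent \<alpha> L s" "tent \<alpha> L s \<le> 1"
proof -
  have "s / \<alpha> \<le> 1 \<or> (L - s) / (L - \<alpha>) \<le> 1"
    using \<alpha> \<alpha>L by (auto simp: divide_le_eq)
  then show "tent \<alpha> L s \<le> 1" by (auto simp: tent_def)
qed (simp add: tent_def)

lemma tent_Lipschitz: "\<bar>tent \<alpha> L r - tent \<alpha> L s\<bar> \<le> (1 / \<alpha> + 1 / (L - \<alpha>)) * \<bar>r - s\<bar>"
proof -
  have "\<bar>tent \<alpha> L r - tent \<alpha> L s\<bar> \<le> \<bar>r / \<alpha> - s / \<alpha>\<bar> + \<bar>(L - r) / (L - \<alpha>) - (L - s) / (L - \<alpha>)\<bar>"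
    unfolding tent_def by linarith
  also have "\<dots> = \<bar>r - s\<bar> / \<alpha> + \<bar>r - s\<bar> / (L - \<alpha>)"
    using \<alpha> \<alpha>L by (simp add: abs_minus_commute flip: diff_divide_distrib)
  also have "\<dots> = (1 / \<alpha> + 1 / (L - \<alpha>)) * \<bar>r - s\<bar>" by (simp add: distrib_right)
  finally show ?thesis .
qed

text \<open>
  The derivative of a primitive of \<open>trapezoid N\<close> composed with the tent. The two branches fit
  together continuously, because \<open>trapezoid N\<close> vanishes at the value \<open>1\<close> that the tent takes at \<open>\<alpha>\<close>.
\<close>

definition tent_slope :: "real \<Rightarrow> real \<Rightarrow> real" where
  "tent_slope N s = (if s \<le> \<alpha> then trapezoid N (tent \<alpha> L s) * (1 / \<alpha>)
                     else trapezoid N (tent \<alpha> L s) * (- (1 / (L - \<alpha>))))"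

lemma continuous_tent: "continuous_on UNIV (tent \<alpha> L)"
  unfolding tent_def [abs_def] by (intro continuous_intros) (use \<alpha> \<alpha>L in auto)

lemma continuous_tent_slope: "continuous_on UNIV (tent_slope N)"
  unfolding tent_slope_def
proof (rule continuous_on_cases_le)
  have c: "continuous_on UNIV (\<lambda>s. trapezoid N (tent \<alpha> L s))"
    by (rule continuous_on_compose2[OF continuous_trapezoid continuous_tent]) simp
  show "continuous_on {t \<in> UNIV. t \<le> \<alpha>} (\<lambda>s. trapezoid N (tent \<alpha> L s) * (1 / \<alpha>))"
    "continuous_on {t \<in> UNIV. \<alpha> \<le> t} (\<lambda>s. trapezoid N (tent \<alpha> L s) * (- (1 / (L - \<alpha>))))"
    by (intro continuous_intros continuous_on_subset[OF c]; simp)+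
  show "trapezoid N (tent \<alpha> L t) * (1 / \<alpha>) = trapezoid N (tent \<alpha> L t) * (- (1 / (L - \<alpha>)))" if "t = \<alpha>" for t
    using that \<alpha> tent_left[of \<alpha>] by simp
qed (auto intro!: continuous_intros)

lemma abs_tent_slope_le: "\<bar>tent_slope N s\<bar> \<le> 1 / \<alpha> + 1 / (L - \<alpha>)"
proof -
  let ?\<theta> = "trapezoid N (tent \<alpha> L s)"
  have "?\<theta> * (1 / \<alpha>) \<le> 1 / \<alpha>" "?\<theta> * (1 / (L - \<alpha>)) \<le> 1 / (L - \<alpha>)"
    "0 \<le> ?\<theta> * (1 / \<alpha>)" "0 \<le> ?\<theta> * (1 / (L - \<alpha>))" "0 \<le> 1 / \<alpha>" "0 \<le> 1 / (L - \<alpha>)"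
    using \<alpha> \<alpha>L trapezoid_bounds[of N "tent \<alpha> L s"]
    by (auto intro!: mult_left_le_one_le mult_nonneg_nonneg simp del: times_divide_eq_right)
  then show ?thesis
    unfolding tent_slope_def mult_minus_right by (auto simp del: times_divide_eq_right)
qed

lemma smoothed_tent_derivative:
  assumes \<phi>: "\<And>y. (\<phi> has_real_derivative trapezoid N y) (at y)"
  shows "((\<lambda>s. \<phi> (tent \<alpha> L s)) has_real_derivative tent_slope N s) (at s)"
proof -
  \<comment> \<open>The first case covers the corners of the tent and everything outside \<open>(0, L)\<close>.\<close>
  consider "trapezoid N (tent \<alpha> L s) = 0" | "0 < s" "s < \<alpha>" | "\<alpha> < s" "s < L"
    using \<alpha> tent_left[of \<alpha>] tent_outside[of s] by (cases "s = \<alpha>") fastforce+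
  then show ?thesis
  proof cases
    case 1
    then have "tent_slope N s = 0" by (simp add: tent_slope_def)
    then show ?thesis
      using 1 \<phi>[of "tent \<alpha> L s"] by (auto intro: DERIV_compose_zero_Lipschitz tent_Lipschitz)
  next
    case 2
    have "((\<lambda>s. \<phi> (s / \<alpha>)) has_real_derivative trapezoid N (s / \<alpha>) * (1 / \<alpha>)) (at s)"
      by (rule DERIV_chain2[OF \<phi>]) (use \<alpha> in \<open>auto intro!: derivative_eq_intros\<close>)
    then have "((\<lambda>s. \<phi> (s / \<alpha>)) has_real_derivative tent_slope N s) (at s)"
      using 2 by (simp add: tent_slope_def tent_left)
    then show ?thesis
      by (rule has_field_derivative_transform_within_open[where S = "{0<..<\<alpha>}"])
        (use 2 tent_left in auto)
  next
    case 3
    have "((\<lambda>s. (L - s) / (L - \<alpha>)) has_real_derivative (0 - 1) / (L - \<alpha>)) (at s)"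
      by (intro DERIV_cdivide DERIV_diff DERIV_const DERIV_ident)
    then have lin: "((\<lambda>s. (L - s) / (L - \<alpha>)) has_real_derivative - (1 / (L - \<alpha>))) (at s)"
      by simp
    have "((\<lambda>s. \<phi> ((L - s) / (L - \<alpha>))) has_real_derivative
        trapezoid N ((L - s) / (L - \<alpha>)) * (- (1 / (L - \<alpha>)))) (at s)"
      by (rule DERIV_chain2[OF \<phi> lin])
    then have "((\<lambda>s. \<phi> ((L - s) / (L - \<alpha>))) has_real_derivative tent_slope N s) (at s)"
      using 3 by (simp add: tent_slope_def tent_right)
    then show ?thesis
      by (rule has_field_derivative_transform_within_open[where S = "{\<alpha><..<L}"])
        (use 3 tent_right in auto)
  qed
qed

lemma tent_slope_nonpos: "s \<le> 0 \<Longrightarrow> tent_slope N s = 0"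
  using \<alpha> tent_outside[of s] by (simp add: tent_slope_def)

lemma tent_slope_tendsto:
  assumes "0 < s" "s < L" "s \<noteq> \<alpha>"
  shows "(\<lambda>n. tent_slope (real (Suc n)) s) \<longlonglongrightarrow> (if s < \<alpha> then 1 / \<alpha> else - (1 / (L - \<alpha>)))"
proof -
  have t: "0 < tent \<alpha> L s" "tent \<alpha> L s < 1"
    using assms \<alpha> \<alpha>L tent_left[of s] tent_right[of s] by (cases "s < \<alpha>"; simp add: divide_less_eq)+
  have "(\<lambda>n. trapezoid (real (Suc n)) (tent \<alpha> L s) * (if s < \<alpha> then 1 / \<alpha> else - (1 / (L - \<alpha>))))
      \<longlonglongrightarrow> 1 * (if s < \<alpha> then 1 / \<alpha> else - (1 / (L - \<alpha>)))"
    by (intro tendsto_intros trapezoid_tendsto t)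
  then show ?thesis
    using assms(3) unfolding tent_slope_def by (cases "s < \<alpha>") (simp_all del: of_nat_Suc)
qed

text \<open>
  The odd extension of the smoothed tent. Since \<open>trapezoid N\<close> vanishes on \<open>[0, 1 / N]\<close>, the smoothed tent
  is already \<open>0\<close> slightly to the left of \<open>L\<close>, so the support is compact in \<open>(- L, L)\<close>.
\<close>

lemma odd_tent_approximation:
  obtains h h' :: "nat \<Rightarrow> real \<Rightarrow> real" and C
  where "\<And>n s. (h n has_real_derivative h' n s) (at s)" "\<And>n. continuous_on UNIV (h' n)"
    "\<And>n. \<exists>r<L. \<forall>s. r \<le> \<bar>s\<bar> \<longrightarrow> h n s = 0" "\<And>n s. \<bar>h n s\<bar> \<le> 1" "\<And>n s. \<bar>h' n s\<bar> \<le> C"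
    "\<And>s. \<bar>s\<bar> < L \<Longrightarrow> s \<notin> {0, \<alpha>, - \<alpha>} \<Longrightarrow>
       (\<lambda>n. h' n s) \<longlonglongrightarrow> (if \<bar>s\<bar> < \<alpha> then 1 / \<alpha> else - (1 / (L - \<alpha>)))"
proof -
  have "\<exists>\<phi>. (\<forall>y. (\<phi> has_real_derivative trapezoid (real (Suc n)) y) (at y)) \<and>
      (\<forall>y. 0 \<le> y \<longrightarrow> y \<le> 1 / real (Suc n) \<longrightarrow> \<phi> y = 0) \<and> (\<forall>y. 0 \<le> y \<longrightarrow> 0 \<le> \<phi> y \<and> \<phi> y \<le> y)" for n
    by (rule trapezoid_primitive[of "real (Suc n)"]) (simp, blast)
  then obtain \<phi> where \<phi>: "\<And>n y. (\<phi> n has_real_derivative trapezoid (real (Suc n)) y) (at y)"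
    "\<And>n y. 0 \<le> y \<Longrightarrow> y \<le> 1 / real (Suc n) \<Longrightarrow> \<phi> n y = 0"
    "\<And>n y. 0 \<le> y \<Longrightarrow> 0 \<le> \<phi> n y \<and> \<phi> n y \<le> y"
    by metis
  define h where "h n s = \<phi> n (tent \<alpha> L s) - \<phi> n (tent \<alpha> L (- s))" for n s
  define h' where "h' n s = tent_slope (real (Suc n)) s + tent_slope (real (Suc n)) (- s)" for n s
  have \<phi>0: "\<phi> n 0 = 0" for n using \<phi>(2)[of 0 n] by simp
  define C where "C = 1 / \<alpha> + 1 / (L - \<alpha>)"
  show thesis
  proof (rule that[of h h' "2 * C"])
    fix n :: nat and s :: real
    have "((\<lambda>s. \<phi> n (tent \<alpha> L (- s))) has_real_derivative tent_slope (real (Suc n)) (- s) * (- 1)) (at s)"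
      by (rule DERIV_chain2[OF smoothed_tent_derivative[OF \<phi>(1)]]) (auto intro!: derivative_eq_intros)
    from DERIV_diff[OF smoothed_tent_derivative[OF \<phi>(1)[of n]] this]
    show "(h n has_real_derivative h' n s) (at s)"
      unfolding h_def h'_def by simp
    have "continuous_on UNIV (\<lambda>s. tent_slope (real (Suc n)) (- s))"
      by (rule continuous_on_compose2[OF continuous_tent_slope]) (auto intro!: continuous_intros)
    then show "continuous_on UNIV (h' n)"
      unfolding h'_def by (intro continuous_intros continuous_tent_slope)
    show "\<bar>h n s\<bar> \<le> 1"
    proof (cases "0 \<le> s")
      case True
      then have "h n s = \<phi> n (tent \<alpha> L s)" by (simp add: h_def tent_outside \<phi>0)
      then show ?thesis using \<phi>(3)[of "tent \<alpha> L s" n] tent_bounds[of s] by simp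
    next
      case False
      then have "h n s = - \<phi> n (tent \<alpha> L (- s))" by (simp add: h_def tent_outside \<phi>0)
      then show ?thesis using \<phi>(3)[of "tent \<alpha> L (- s)" n] tent_bounds[of "- s"] by simp
    qed
    show "\<bar>h' n s\<bar> \<le> 2 * C"
      using abs_tent_slope_le[of "real (Suc n)" s] abs_tent_slope_le[of "real (Suc n)" "- s"]
      unfolding h'_def C_def[symmetric] by linarith
  next
    fix n :: nat
    define r where "r = L - (L - \<alpha>) / real (Suc n)"
    have r: "r < L" "\<alpha> \<le> r"
      using \<alpha>L divide_left_mono[of 1 "real (Suc n)" "L - \<alpha>"] by (simp_all add: r_def)
    have "\<phi> n (tent \<alpha> L s) = 0" if "r \<le> s \<or> s \<le> 0" for s
    proof (cases "L \<le> s \<or> s \<le> 0")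
      case False
      with that r have s: "\<alpha> \<le> s" "s \<le> L" "r \<le> s" by auto
      then have "L - s \<le> (L - \<alpha>) / real (Suc n)" by (simp add: r_def)
      then have "(L - s) / (L - \<alpha>) \<le> 1 / real (Suc n)"
        using \<alpha>L by (simp add: field_simps)
      with s show ?thesis using \<alpha>L by (simp add: tent_right \<phi>(2))
    qed (auto simp: tent_outside \<phi>0)
    then have "h n s = 0" if "r \<le> \<bar>s\<bar>" for s
      using that r \<alpha> by (cases "0 \<le> s") (simp_all add: h_def)
    with r(1) show "\<exists>r<L. \<forall>s. r \<le> \<bar>s\<bar> \<longrightarrow> h n s = 0" by blast
  next
    fix s assume s: "\<bar>s\<bar> < L" "s \<notin> {0, \<alpha>, - \<alpha>}"
    show "(\<lambda>n. h' n s) \<longlonglongrightarrow> (if \<bar>s\<bar> < \<alpha> then 1 / \<alpha> else - (1 / (L - \<alpha>)))"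
    proof (cases "0 < s")
      case True
      then show ?thesis
        using s tent_slope_tendsto[of s] by (simp add: h'_def tent_slope_nonpos)
    next
      case False
      then show ?thesis
        using s tent_slope_tendsto[of "- s"] by (simp add: h'_def tent_slope_nonpos)
    qed
  qed
qed

end

definition ramp :: "real \<Rightarrow> real \<Rightarrow> real" where
  "ramp N y = max 0 (N * y - 1)"

text \<open>
  A \<open>C\<^sup>1\<close> approximation of the indicator function of the positive numbers, vanishing on \<open>(- \<infinity>, 1 / N]\<close>.
\<close>

definition smooth_step :: "real \<Rightarrow> real \<Rightarrow> real" where
  "smooth_step N y = (ramp N y)\<^sup>2 / (1 + (ramp N y)\<^sup>2)"

lemma one_plus_square_neq_0 [simp]: "1 + x\<^sup>2 \<noteq> (0::real)"
  by (metis add_pos_nonneg less_irrefl zero_le_power2 zero_less_one)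

lemma continuous_ramp: "continuous_on UNIV (ramp N)"
  unfolding ramp_def [abs_def] by (intro continuous_intros)

lemma square_ramp_derivative: "((\<lambda>y. (ramp N y)\<^sup>2) has_real_derivative 2 * N * ramp N y) (at y)"
proof -
  have pos_part: "((\<lambda>x. (max 0 x)\<^sup>2) has_real_derivative 2 * max 0 x) (at x)" for x :: real
  proof -
    \<comment> \<open>The corner of the positive part sits at the level \<open>0\<close>, where the square is flat.\<close>
    consider "x = 0" | "0 < x" | "x < 0" by linarith
    then show ?thesis
    proof cases
      case 1
      have "((\<lambda>x. x\<^sup>2) has_real_derivative 0) (at (max 0 x))"
        using 1 by (auto intro!: derivative_eq_intros)
      then have "((\<lambda>x. (max 0 x)\<^sup>2) has_real_derivative 0) (at x)"
        by (rule DERIV_compose_zero_Lipschitz[where B = 1]) (auto simp: max_def)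
      then show ?thesis using 1 by simp
    next
      case 2
      have "((\<lambda>x. x\<^sup>2) has_real_derivative 2 * max 0 x) (at x)"
        using 2 by (auto intro!: derivative_eq_intros)
      then show ?thesis
        by (rule has_field_derivative_transform_within_open[where S = "{0<..}"]) (use 2 in auto)
    next
      case 3
      have "((\<lambda>x. 0) has_real_derivative 2 * max 0 x) (at x)"
        using 3 by (auto intro!: derivative_eq_intros)
      then show ?thesis
        by (rule has_field_derivative_transform_within_open[where S = "{..<0}"]) (use 3 in auto)
    qed
  qed
  have "((\<lambda>y. N * y - 1) has_real_derivative N) (at y)"
    by (auto intro!: derivative_eq_intros)
  from DERIV_chain2[OF pos_part this] show ?thesis
    unfolding ramp_def by (simp add: ac_simps)
qed

lemma smooth_step_derivative:
  "(smooth_step N has_real_derivative 2 * N * ramp N y / (1 + (ramp N y)\<^sup>2)\<^sup>2) (at y)"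
proof -
  have "((\<lambda>y. 1 + (ramp N y)\<^sup>2) has_real_derivative 0 + 2 * N * ramp N y) (at y)"
    by (intro DERIV_add DERIV_const square_ramp_derivative)
  from DERIV_divide[OF square_ramp_derivative this]
  have "(smooth_step N has_real_derivative
      (2 * N * ramp N y * (1 + (ramp N y)\<^sup>2) - (ramp N y)\<^sup>2 * (0 + 2 * N * ramp N y))
        / ((1 + (ramp N y)\<^sup>2) * (1 + (ramp N y)\<^sup>2))) (at y)"
    unfolding smooth_step_def [abs_def] by simp
  then show ?thesis by (simp add: algebra_simps power2_eq_square)
qed

lemma smooth_step_bounds: "0 \<le> smooth_step N y" "smooth_step N y \<le> 1"
  unfolding smooth_step_def by (simp_all add: divide_le_eq add_pos_nonneg)

lemma smooth_step_eq_0: "0 < N \<Longrightarrow> y \<le> 1 / N \<Longrightarrow> smooth_step N y = 0"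
  by (simp add: smooth_step_def ramp_def field_simps)

lemma smooth_step_tendsto:
  "(\<lambda>n. smooth_step (real (Suc n)) y) \<longlonglongrightarrow> (if 0 < y then 1 else 0)"
proof (cases "0 < y")
  case True
  have "filterlim (\<lambda>n. y * real (Suc n)) at_top sequentially"
    using True by (intro filterlim_tendsto_pos_mult_at_top[OF tendsto_const]
        filterlim_compose[OF filterlim_real_sequentially filterlim_Suc]) auto
  then have "filterlim (\<lambda>n. - 1 + y * real (Suc n)) at_top sequentially"
    by (rule filterlim_tendsto_add_at_top[OF tendsto_const])
  then have "filterlim (\<lambda>n. 1 + (ramp (real (Suc n)) y)\<^sup>2) at_top sequentially"
  proof (rule filterlim_at_top_mono, intro always_eventually allI)
    fix n
    let ?m = "ramp (real (Suc n)) y"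
    have "- 1 + y * real (Suc n) \<le> ?m" by (simp add: ramp_def mult.commute)
    also have "?m \<le> 1 + ?m\<^sup>2"
      using zero_le_power2[of "?m - 1 / 2"] zero_le_power2[of ?m] by (simp add: power2_diff power_divide)
    finally show "- 1 + y * real (Suc n) \<le> 1 + ?m\<^sup>2" .
  qed
  then have "(\<lambda>n. 1 - inverse (1 + (ramp (real (Suc n)) y)\<^sup>2)) \<longlonglongrightarrow> 1 - 0"
    by (intro tendsto_intros tendsto_inverse_0_at_top)
  moreover have "1 - inverse (1 + x\<^sup>2) = x\<^sup>2 / (1 + x\<^sup>2)" for x :: real
    by (simp add: field_simps)
  ultimately show ?thesis using True by (simp add: smooth_step_def)
next
  case False
  then have "smooth_step (real (Suc n)) y = 0" for n
    by (intro smooth_step_eq_0) (auto intro: order_trans[of _ 0])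
  then show ?thesis using False by simp
qed

text \<open>
  The jump function is the combination \<open>\<beta> 1\<^bsub>(- L, L)\<^esub> + (1 - \<beta>) 1\<^bsub>(- \<alpha>, \<alpha>)\<^esub>\<close> of indicator functions, and
  \<open>(- r, r)\<close> is the set where \<open>r\<^sup>2 - s\<^sup>2\<close> is positive.
\<close>

lemma plateau_approximation:
  fixes \<alpha> \<beta> L :: real
  assumes "0 < \<alpha>" "\<alpha> < L" "0 \<le> \<beta>" "\<beta> \<le> 1"
  obtains k k' :: "nat \<Rightarrow> real \<Rightarrow> real"
  where "\<And>n s. (k n has_real_derivative k' n s) (at s)" "\<And>n. continuous_on UNIV (k' n)"
    "\<And>n. \<exists>r<L. \<forall>s. r \<le> \<bar>s\<bar> \<longrightarrow> k n s = 0" "\<And>n s. \<bar>k n s\<bar> \<le> 1"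
    "\<And>s. \<bar>s\<bar> < L \<Longrightarrow> (\<lambda>n. k n s) \<longlonglongrightarrow> (if \<bar>s\<bar> < \<alpha> then 1 else \<beta>)"
proof -
  define d where "d n y = 2 * real (Suc n) * ramp (real (Suc n)) y / (1 + (ramp (real (Suc n)) y)\<^sup>2)\<^sup>2" for n y
  define S where "S n = smooth_step (real (Suc n))" for n
  define k where "k n s = \<beta> * S n (L\<^sup>2 - s\<^sup>2) + (1 - \<beta>) * S n (\<alpha>\<^sup>2 - s\<^sup>2)" for n s
  define k' where "k' n s = \<beta> * (d n (L\<^sup>2 - s\<^sup>2) * (- 2 * s)) + (1 - \<beta>) * (d n (\<alpha>\<^sup>2 - s\<^sup>2) * (- 2 * s))" for n s
  have S: "(S n has_real_derivative d n y) (at y)" for n y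
    unfolding S_def d_def by (rule smooth_step_derivative)
  have sq: "r\<^sup>2 - s\<^sup>2 > 0 \<longleftrightarrow> \<bar>s\<bar> < r" if "0 < r" for r s :: real
    using that abs_le_square_iff[of r s] by (auto simp: not_le[symmetric])
  show thesis
  proof (rule that[of k k'])
    fix n s
    have "((\<lambda>s. S n (c - s\<^sup>2)) has_real_derivative d n (c - s\<^sup>2) * (- 2 * s)) (at s)" for c
      by (rule DERIV_chain2[OF S]) (auto intro!: derivative_eq_intros)
    then show "(k n has_real_derivative k' n s) (at s)"
      unfolding k_def k'_def by (intro DERIV_add DERIV_cmult)
    show "\<bar>k n s\<bar> \<le> 1"
    proof -
      have "0 \<le> k n s"
        unfolding k_def S_def using assms smooth_step_bounds by (intro add_nonneg_nonneg mult_nonneg_nonneg) auto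
      moreover have "k n s \<le> \<beta> * 1 + (1 - \<beta>) * 1"
        unfolding k_def S_def using assms smooth_step_bounds by (intro add_mono mult_left_mono) auto
      ultimately show ?thesis by simp
    qed
  next
    fix n
    have "continuous_on UNIV (\<lambda>s. ramp (real (Suc n)) (c - s\<^sup>2))" for c
      by (rule continuous_on_compose2[OF continuous_ramp]) (auto intro!: continuous_intros)
    then show "continuous_on UNIV (k' n)"
      unfolding k'_def d_def by (intro continuous_intros) auto
  next
    fix n
    define r where "r = sqrt (max 0 (L\<^sup>2 - 1 / real (Suc n)))"
    have "max 0 (L\<^sup>2 - 1 / real (Suc n)) < L\<^sup>2" using assms by simp
    then have "r < L"
      unfolding r_def using assms by (intro real_less_lsqrt) auto
    moreover have "k n s = 0" if "r \<le> \<bar>s\<bar>" for s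
    proof -
      have "r\<^sup>2 \<le> \<bar>s\<bar>\<^sup>2"
        using that by (intro power_mono) (simp_all add: r_def)
      then have "max 0 (L\<^sup>2 - 1 / real (Suc n)) \<le> s\<^sup>2"
        by (simp add: r_def)
      then have "L\<^sup>2 - s\<^sup>2 \<le> 1 / real (Suc n)" by simp
      moreover have "\<alpha>\<^sup>2 \<le> L\<^sup>2" using assms by (intro power_mono) auto
      ultimately show ?thesis
        unfolding k_def S_def by (simp add: smooth_step_eq_0 del: of_nat_Suc)
    qed
    ultimately show "\<exists>r<L. \<forall>s. r \<le> \<bar>s\<bar> \<longrightarrow> k n s = 0" by blast
  next
    fix s assume s: "\<bar>s\<bar> < L"
    have "(\<lambda>n. k n s) \<longlonglongrightarrow> \<beta> * (if 0 < L\<^sup>2 - s\<^sup>2 then 1 else 0) + (1 - \<beta>) * (if 0 < \<alpha>\<^sup>2 - s\<^sup>2 then 1 else 0)"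
      unfolding k_def S_def by (intro tendsto_intros smooth_step_tendsto)
    then show "(\<lambda>n. k n s) \<longlonglongrightarrow> (if \<bar>s\<bar> < \<alpha> then 1 else \<beta>)"
      using s assms unfolding sq[OF assms(1)] sq[OF less_trans[OF assms(1,2)]] by (simp split: if_splits)
  qed
qed

section \<open>The calibration of a square well\<close>

text \<open>
  The height \<open>\<beta> = \<alpha> / (L + \<alpha>)\<close> of \<open>k\<close> outside \<open>(- \<alpha>, \<alpha>)\<close> is forced: the divergence must take the same
  value \<open>2 \<alpha> / (L\<^sup>2 - \<alpha>\<^sup>2)\<close> in the strips next to the small square (fact \<open>mixed\<close>) and in the corners of the
  large one (fact \<open>corner\<close>). As \<open>\<beta> \<le> 1\<close>, the field is admissible.
\<close>

lemma calibration_le_\<Phi>\<^sub>0: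
  assumes \<alpha>: "0 < \<alpha>" and \<alpha>L: "\<alpha> < L" and v: "v \<in> L2 (open_square L)"
  shows "ereal (L2_inner (open_square L) (two_level \<alpha> (- (2 / \<alpha>)) (2 * \<alpha> / (L\<^sup>2 - \<alpha>\<^sup>2))) v)
         \<le> \<Phi>\<^sub>0 (open_square L) v"
proof -
  define \<beta> where "\<beta> = \<alpha> / (L + \<alpha>)"
  have \<beta>: "0 \<le> \<beta>" "\<beta> \<le> 1" using \<alpha> \<alpha>L by (simp_all add: \<beta>_def)
  define H where "H s = (if \<bar>s\<bar> < \<alpha> then 1 / \<alpha> else - (1 / (L - \<alpha>)))" for s
  define K where "K s = (if \<bar>s\<bar> < \<alpha> then 1 else \<beta>)" for s
  obtain h h' :: "nat \<Rightarrow> real \<Rightarrow> real" and C where h: "\<And>n s. (h n has_real_derivative h' n s) (at s)" "\<And>n. continuous_on UNIV (h' n)"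
    "\<And>n. \<exists>r<L. \<forall>s. r \<le> \<bar>s\<bar> \<longrightarrow> h n s = 0" "\<And>n s. \<bar>h n s\<bar> \<le> 1" "\<And>n s. \<bar>h' n s\<bar> \<le> C"
    "\<And>s. \<bar>s\<bar> < L \<Longrightarrow> s \<notin> {0, \<alpha>, - \<alpha>} \<Longrightarrow> (\<lambda>n. h' n s) \<longlonglongrightarrow> (if \<bar>s\<bar> < \<alpha> then 1 / \<alpha> else - (1 / (L - \<alpha>)))"
    by (rule odd_tent_approximation[OF \<alpha> \<alpha>L]) (rule that; assumption)
  obtain k k' :: "nat \<Rightarrow> real \<Rightarrow> real" where k: "\<And>n s. (k n has_real_derivative k' n s) (at s)" "\<And>n. continuous_on UNIV (k' n)"
    "\<And>n. \<exists>r<L. \<forall>s. r \<le> \<bar>s\<bar> \<longrightarrow> k n s = 0" "\<And>n s. \<bar>k n s\<bar> \<le> 1"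
    "\<And>s. \<bar>s\<bar> < L \<Longrightarrow> (\<lambda>n. k n s) \<longlonglongrightarrow> (if \<bar>s\<bar> < \<alpha> then 1 else \<beta>)"
    by (rule plateau_approximation[OF \<alpha> \<alpha>L \<beta>]) (rule that; assumption)
  have sq: "L\<^sup>2 - \<alpha>\<^sup>2 = (L - \<alpha>) * (L + \<alpha>)" by (simp add: power2_eq_square algebra_simps)
  have mixed: "\<beta> / \<alpha> - 1 / (L - \<alpha>) = - (2 * \<alpha> / (L\<^sup>2 - \<alpha>\<^sup>2))"
  proof -
    have "\<beta> / \<alpha> - 1 / (L - \<alpha>) = 1 / (L + \<alpha>) - 1 / (L - \<alpha>)" using \<alpha> by (simp add: \<beta>_def)
    also have "\<dots> = - (2 * \<alpha> / ((L - \<alpha>) * (L + \<alpha>)))" using \<alpha> \<alpha>L by (simp add: divide_simps)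
    finally show ?thesis by (simp add: sq)
  qed
  have corner: "2 * (\<beta> / (L - \<alpha>)) = 2 * \<alpha> / (L\<^sup>2 - \<alpha>\<^sup>2)"
    by (simp add: \<beta>_def sq mult.commute)
  show ?thesis
  proof (rule tensor_calibration[where N = "{0, \<alpha>, - \<alpha>}", OF h(1,2) k(1,2) h(3) k(3) h(4) k(4) h(5) _ h(6)[folded H_def] k(5)[folded K_def] two_level_L2 _ v])
    fix x :: "real^2" assume "x \<in> open_square L"
    show "two_level \<alpha> (- (2 / \<alpha>)) (2 * \<alpha> / (L\<^sup>2 - \<alpha>\<^sup>2)) x = - (K (x $ 2) * H (x $ 1) + K (x $ 1) * H (x $ 2))"
      using mixed corner by (auto simp: two_level_def open_square_def K_def H_def)
  qed auto
qed

text \<open>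
  The linear functional given by \<open>w\<close> lies below \<open>\<Phi>\<close> and touches it at \<open>u\<close>, so it is a supporting
  hyperplane there.
\<close>

lemma calibrated_imp_subdifferential:
  assumes w: "w \<in> L2 \<Omega>" and u: "u \<in> L2 \<Omega>"
    and le: "\<And>v. v \<in> L2 \<Omega> \<Longrightarrow> ereal (L2_inner \<Omega> w v) \<le> \<Phi> v"
    and ge: "\<Phi> u \<le> ereal (L2_inner \<Omega> w u)"
  shows "w \<in> L2_subdifferential \<Omega> \<Phi> u"
  unfolding L2_subdifferential_def
proof (intro CollectI conjI ballI w u)
  show "\<Phi> u < \<infinity>" using ge by (rule le_less_trans) simp
  fix v assume v: "v \<in> L2 \<Omega>"
  have "\<Phi> u + ereal (L2_inner \<Omega> w (\<lambda>x. v x - u x))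
      \<le> ereal (L2_inner \<Omega> w u) + ereal (L2_inner \<Omega> w (\<lambda>x. v x - u x))"
    by (intro add_right_mono ge)
  also have "\<dots> = ereal (L2_inner \<Omega> w v)"
    by (simp add: L2_inner_diff_right w u v)
  also have "\<dots> \<le> \<Phi> v" by (rule le[OF v])
  finally show "\<Phi> u + ereal (L2_inner \<Omega> w (\<lambda>x. v x - u x)) \<le> \<Phi> v" .
qed

lemma two_level_velocity_in_subdifferential:
  assumes \<alpha>: "0 < \<alpha>" and \<alpha>L: "\<alpha> < L" and pq: "p \<le> q"
  shows "two_level \<alpha> (- (2 / \<alpha>)) (2 * \<alpha> / (L\<^sup>2 - \<alpha>\<^sup>2))
         \<in> L2_subdifferential (open_square L) (\<Phi>\<^sub>0 (open_square L)) (two_level \<alpha> p q)"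
proof (intro calibrated_imp_subdifferential two_level_L2 calibration_le_\<Phi>\<^sub>0[OF \<alpha> \<alpha>L])
  have "\<alpha>\<^sup>2 < L\<^sup>2" using assms by (intro power_strict_mono) auto
  then have "L2_inner (open_square L) (two_level \<alpha> (- (2 / \<alpha>)) (2 * \<alpha> / (L\<^sup>2 - \<alpha>\<^sup>2))) (two_level \<alpha> p q)
      = 8 * \<alpha> * (q - p)"
    using \<alpha> \<alpha>L by (simp add: L2_inner_two_level power2_eq_square[of \<alpha>] field_simps)
  then show "\<Phi>\<^sub>0 (open_square L) (two_level \<alpha> p q)
      \<le> ereal (L2_inner (open_square L) (two_level \<alpha> (- (2 / \<alpha>)) (2 * \<alpha> / (L\<^sup>2 - \<alpha>\<^sup>2))) (two_level \<alpha> p q))"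
    using \<Phi>\<^sub>0_two_level_le[of \<alpha> L p q] assms by simp
qed

text \<open>
  Constants minimise \<open>\<Phi>\<^sub>0\<close>; so the flow stops once the two levels have met.
\<close>

lemma zero_in_subdifferential_const:
  assumes "0 < \<alpha>" "\<alpha> < L"
  shows "(\<lambda>x. 0) \<in> L2_subdifferential (open_square L) (\<Phi>\<^sub>0 (open_square L)) (two_level \<alpha> q q)"
proof (rule calibrated_imp_subdifferential)
  show "(\<lambda>x. 0) \<in> L2 (open_square L)" by (simp add: L2_def)
  show "two_level \<alpha> q q \<in> L2 (open_square L)" by (rule two_level_L2)
  show "ereal (L2_inner (open_square L) (\<lambda>x. 0) v) \<le> \<Phi>\<^sub>0 (open_square L) v" for v
    using \<Phi>\<^sub>0_nonneg by (simp add: L2_inner_def zero_ereal_def[symmetric])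
  show "\<Phi>\<^sub>0 (open_square L) (two_level \<alpha> q q) \<le> ereal (L2_inner (open_square L) (\<lambda>x. 0) (two_level \<alpha> q q))"
    using \<Phi>\<^sub>0_two_level_le[of \<alpha> L q q] assms by (simp add: L2_inner_def)
qed

section \<open>The solution\<close>

text \<open>
  The profile after the time \<open>s\<close> of active motion. As the central region it uses the open square, so
  that it agrees with the initial datum at every point when \<open>s = 0\<close>.
\<close>

definition square_flow :: "real \<Rightarrow> real \<Rightarrow> real \<Rightarrow> real \<Rightarrow> real^2 \<Rightarrow> real" where
  "square_flow \<alpha> L M s = two_level \<alpha> (2 * s / \<alpha> - M) (- (2 * \<alpha> / (L\<^sup>2 - \<alpha>\<^sup>2)) * s)"

text \<open>
  Differences of the candidate at two times are multiples of the velocity \<open>w\<close>, which gives the Lipschitz bound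
  and makes the right difference quotients equal to \<open>w\<close> before \<open>T\<close> and to \<open>0\<close> from \<open>T\<close> on. Up to
  time \<open>T\<close> the inner level stays below the outer one, as the calibration requires.
\<close>

lemma square_flow_solution:
  assumes \<alpha>: "0 < \<alpha>" and \<alpha>L: "\<alpha> < L" and M: "0 < M"
    and T: "T = M * inverse (2 / \<alpha> + 2 * \<alpha> / (L\<^sup>2 - \<alpha>\<^sup>2))"
  shows "neumann_flow_solution (open_square L) (\<lambda>x. - M * indicator (open_square \<alpha>) x)
           (\<lambda>t. square_flow \<alpha> L M (min t T))"
proof -
  define c where "c = 2 * \<alpha> / (L\<^sup>2 - \<alpha>\<^sup>2)"
  let ?\<Omega> = "open_square L"
  define U where "U t = square_flow \<alpha> L M (min t T)" for t
  define w where "w = two_level \<alpha> (2 / \<alpha>) (- c)"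
  have "\<alpha>\<^sup>2 < L\<^sup>2" using \<alpha> \<alpha>L by (intro power_strict_mono) auto
  then have c: "0 < c" using \<alpha> by (simp add: c_def)
  then have rate: "0 < 2 / \<alpha> + c" using \<alpha> by (simp add: add_pos_pos)
  have T_eq: "T * (2 / \<alpha> + c) = M" using rate by (simp add: T c_def[symmetric])
  have T_pos: "0 < T" using M rate by (simp add: T c_def[symmetric])
  have U_L2: "U t \<in> L2 ?\<Omega>" for t
    unfolding U_def square_flow_def by (rule two_level_L2)
  have w_L2: "w \<in> L2 ?\<Omega>" unfolding w_def by (rule two_level_L2)
  have U_diff: "(\<lambda>x. U s x - U t x) = (\<lambda>x. (min s T - min t T) * w x)" for s t
    by (auto simp: U_def square_flow_def two_level_def w_def c_def algebra_simps diff_divide_distrib)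
  have Lip: "L2_norm_on ?\<Omega> (\<lambda>x. U s x - U t x) \<le> L2_norm_on ?\<Omega> w * \<bar>s - t\<bar>" for s t
  proof -
    have "\<bar>min s T - min t T\<bar> \<le> \<bar>s - t\<bar>" by linarith
    then show ?thesis
      unfolding U_diff L2_norm_on_cmult by (subst mult.commute) (simp add: mult_left_mono)
  qed
  have norm_0: "L2_norm_on ?\<Omega> (\<lambda>x. 0) = 0" by (simp add: L2_norm_on_def L2_inner_def)
  have "neumann_flow_solution ?\<Omega> (\<lambda>x. - M * indicator (open_square \<alpha>) x) U"
    unfolding neumann_flow_solution_def
  proof (intro conjI allI impI)
    show "U t \<in> L2 ?\<Omega>" for t by (rule U_L2)
    show "((\<lambda>s. L2_norm_on ?\<Omega> (\<lambda>x. U s x - U t x)) \<longlongrightarrow> 0) (at t within {0..})" for t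
    proof (rule Lim_null_comparison)
      have "((\<lambda>s. L2_norm_on ?\<Omega> w * \<bar>s - t\<bar>) \<longlongrightarrow> L2_norm_on ?\<Omega> w * \<bar>t - t\<bar>) (at t within {0..})"
        by (intro tendsto_intros)
      then show "((\<lambda>s. L2_norm_on ?\<Omega> w * \<bar>s - t\<bar>) \<longlongrightarrow> 0) (at t within {0..})" by simp
    qed (simp add: Lip)
    show "\<exists>C. \<forall>s\<ge>\<delta>. \<forall>t\<ge>\<delta>. L2_norm_on ?\<Omega> (\<lambda>x. U s x - U t x) \<le> C * \<bar>s - t\<bar>" for \<delta>
      using Lip by blast
    have "U 0 x = - M * indicator (open_square \<alpha>) x" for x
      using T_pos by (simp add: U_def square_flow_def two_level_def)
    then show "AE x in lebesgue_on ?\<Omega>. U 0 x = - M * indicator (open_square \<alpha>) x" by simp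
    fix t :: real assume t: "0 < t"
    show "\<exists>w. L2_has_right_derivative ?\<Omega> U w t \<and> (\<lambda>x. - w x) \<in> L2_subdifferential ?\<Omega> (\<Phi>\<^sub>0 ?\<Omega>) (U t)"
    proof (cases "t < T")
      case True
      have "\<forall>\<^sub>F h in at_right 0. h < T - t"
        using True by (intro order_tendstoD[OF tendsto_ident_at]) auto
      with eventually_at_right_less[of "0::real"]
      have "\<forall>\<^sub>F h in at_right 0. L2_norm_on ?\<Omega> (\<lambda>x. (U (t + h) x - U t x) / h - w x) = 0"
      proof eventually_elim
        case (elim h)
        then have "U (t + h) x - U t x = h * w x" for x
          using fun_cong[OF U_diff[of "t + h" t], of x] True by simp
        then show ?case using elim norm_0 by simp
      qed
      then have "L2_has_right_derivative ?\<Omega> U w t"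
        unfolding L2_has_right_derivative_def using w_L2 by (auto intro: tendsto_eventually)
      moreover have "(\<lambda>x. - w x) \<in> L2_subdifferential ?\<Omega> (\<Phi>\<^sub>0 ?\<Omega>) (U t)"
      proof -
        have "t * (2 / \<alpha> + c) \<le> M" using True rate by (subst T_eq[symmetric]) (intro mult_right_mono; simp)
        then have "2 * t / \<alpha> - M \<le> - c * t" by (simp add: algebra_simps)
        from two_level_velocity_in_subdifferential[OF \<alpha> \<alpha>L this]
        have "two_level \<alpha> (- (2 / \<alpha>)) c \<in> L2_subdifferential ?\<Omega> (\<Phi>\<^sub>0 ?\<Omega>) (U t)"
          using True by (simp add: U_def square_flow_def c_def)
        moreover have "(\<lambda>x. - w x) = two_level \<alpha> (- (2 / \<alpha>)) c"
          by (auto simp: w_def two_level_def)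
        ultimately show ?thesis by simp
      qed
      ultimately show ?thesis by blast
    next
      case False
      have "\<forall>\<^sub>F h in at_right 0. L2_norm_on ?\<Omega> (\<lambda>x. (U (t + h) x - U t x) / h - 0) = 0"
        using eventually_at_right_less[of "0::real"]
      proof eventually_elim
        case (elim h)
        then have "U (t + h) x - U t x = 0" for x
          using fun_cong[OF U_diff[of "t + h" t], of x] False by simp
        then show ?case using norm_0 by simp
      qed
      then have "L2_has_right_derivative ?\<Omega> U (\<lambda>x. 0) t"
        unfolding L2_has_right_derivative_def by (auto simp: L2_def intro: tendsto_eventually)
      moreover have "(\<lambda>x. - 0) \<in> L2_subdifferential ?\<Omega> (\<Phi>\<^sub>0 ?\<Omega>) (U t)"
      proof -
        have "2 * T / \<alpha> - M = - c * T" using T_eq by (simp add: algebra_simps)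
        then have "U t = two_level \<alpha> (- c * T) (- c * T)"
          using False by (simp add: U_def square_flow_def c_def)
        then show ?thesis using zero_in_subdifferential_const[OF \<alpha> \<alpha>L] by simp
      qed
      ultimately show ?thesis by blast
    qed
  qed
  then show ?thesis by (simp add: U_def [abs_def])
qed

lemma square_flow_AE_closed_square:
  "AE x in lebesgue_on (open_square L). square_flow \<alpha> L M t x
     = (if \<bar>x $ 1\<bar> \<le> \<alpha> \<and> \<bar>x $ 2\<bar> \<le> \<alpha> then 2 * t / \<alpha> - M else - (2 * \<alpha> / (L\<^sup>2 - \<alpha>\<^sup>2)) * t)"
proof -
  have "AE x in lebesgue_on (open_square L). x \<notin> {x. x $ 1 \<in> {\<alpha>, - \<alpha>} \<or> x $ 2 \<in> {\<alpha>, - \<alpha>}}"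
    by (intro AE_not_negligible negligible_coordinates_in_finite open_square_sets) simp
  then show ?thesis
  proof eventually_elim
    case (elim x)
    then have "x \<in> open_square \<alpha> \<longleftrightarrow> \<bar>x $ 1\<bar> \<le> \<alpha> \<and> \<bar>x $ 2\<bar> \<le> \<alpha>"
      by (auto simp: open_square_def abs_if split: if_splits)
    then show ?case by (simp add: square_flow_def two_level_def)
  qed
qed

theorem proposition2p2:
  fixes L \<alpha> M T\<^sub>e\<^sub>x\<^sub>t :: real
    and \<Omega> :: "(real^2) set"
    and u\<^sub>0 :: "real^2 \<Rightarrow> real"
  assumes "0 < L" and "0 < \<alpha>" and "\<alpha> < L" and "0 < M"
    and "\<Omega> = open_square L"
    and "u\<^sub>0 = (\<lambda>x. - M * indicator (open_square \<alpha>) x)"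
    and "T\<^sub>e\<^sub>x\<^sub>t = M * inverse (2 / \<alpha> + 2 * \<alpha> / (L\<^sup>2 - \<alpha>\<^sup>2))"
  shows "(\<exists>u. neumann_flow_solution \<Omega> u\<^sub>0 u) \<and>
         (\<forall>u v. neumann_flow_solution \<Omega> u\<^sub>0 u \<and> neumann_flow_solution \<Omega> u\<^sub>0 v \<longrightarrow>
            (\<forall>t\<ge>0. AE x in lebesgue_on \<Omega>. u t x = v t x)) \<and>
         (\<forall>u. neumann_flow_solution \<Omega> u\<^sub>0 u \<longrightarrow>
            (\<forall>t\<in>{0..T\<^sub>e\<^sub>x\<^sub>t}. AE x in lebesgue_on \<Omega>.
               u t x = (if \<bar>x $ 1\<bar> \<le> \<alpha> \<and> \<bar>x $ 2\<bar> \<le> \<alpha> then 2 * t / \<alpha> - M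
                        else - (2 * \<alpha> / (L\<^sup>2 - \<alpha>\<^sup>2)) * t)))"
proof (intro conjI allI impI ballI)
  let ?U = "\<lambda>t. square_flow \<alpha> L M (min t T\<^sub>e\<^sub>x\<^sub>t)"
  have U: "neumann_flow_solution \<Omega> u\<^sub>0 ?U"
    unfolding assms(5,6) by (rule square_flow_solution[OF assms(2,3,4,7)])
  then show "\<exists>u. neumann_flow_solution \<Omega> u\<^sub>0 u" by blast
  show "AE x in lebesgue_on \<Omega>. u t x = v t x"
    if "neumann_flow_solution \<Omega> u\<^sub>0 u \<and> neumann_flow_solution \<Omega> u\<^sub>0 v" "0 \<le> t" for u v t
    using that neumann_flow_unique by blast
  fix u t assume u: "neumann_flow_solution \<Omega> u\<^sub>0 u" and t: "t \<in> {0..T\<^sub>e\<^sub>x\<^sub>t}"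
  then have "AE x in lebesgue_on \<Omega>. u t x = ?U t x"
    by (intro neumann_flow_unique[OF u U]) simp
  moreover have "AE x in lebesgue_on \<Omega>. square_flow \<alpha> L M t x
     = (if \<bar>x $ 1\<bar> \<le> \<alpha> \<and> \<bar>x $ 2\<bar> \<le> \<alpha> then 2 * t / \<alpha> - M else - (2 * \<alpha> / (L\<^sup>2 - \<alpha>\<^sup>2)) * t)"
    unfolding assms(5) by (rule square_flow_AE_closed_square)
  ultimately show "AE x in lebesgue_on \<Omega>. u t x = (if \<bar>x $ 1\<bar> \<le> \<alpha> \<and> \<bar>x $ 2\<bar> \<le> \<alpha> then 2 * t / \<alpha> - M
                        else - (2 * \<alpha> / (L\<^sup>2 - \<alpha>\<^sup>2)) * t)"
    by eventually_elim (use t in simp)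
qed

end
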